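(* Let $\mathcal T$ be a locally finite tree without leaves and without isolated points in its boundary. Let $G\le\operatorname{Aut}(\mathcal T)$ be a closed subgroup having Tits' Independence Property. Then there exists a unique group topology on $\mathcal F(G)$ such that $G\le\mathcal F(G)$ is an open subgroup, i.e. such that the inclusion $G\hookrightarrow\mathcal F(G)$ (with $G$ carrying the subspace topology from $\operatorname{Aut}(\mathcal T)$) is continuous and open.
   Context: $\operatorname{Aut}(\mathcal T)$ carries the group topology in which the pointwise fixators of finite sets of vertices and edges form a neighbourhood basis of the identity. For $G\le\operatorname{Aut}(\mathcal T)$ and a subset $L$ of $\mathcal T$, $\operatorname{Fix}_G(L)$ is the pointwise fixator of $L$ in $G$. Tits' Independence Property: let $L$ be a (finite or infinite) path in $\mathcal T$; for each vertex $v$ of $\mathcal T$ let $\pi(v)$ be the vertex of $L$ closest to $v$, and for each vertex $w$ of $L$ let $L_w$ be the subtree spanned by $\pi^{-1}(w)$. $\operatorname{Fix}_G(L)$ leaves each $L_w$ invariant. $G$ has Tits' Independence Property if for every path $L$ the restriction map $\operatorname{Fix}_G(L)\to\prod_w\operatorname{Fix}_G(L)|_{L_w}$ is an isomorphism. Almost automorphisms: fix a root $v_0$ of $\mathcal T$; the children of a vertex $v$ are its neighbours farther from $v_0$, and $\mathcal T_v$ is the subtree of all vertices $w$ such that $v$ lies on the geodesic from $v_0$ to $w$. The boundary $\partial\mathcal T$ is the set of infinite geodesics starting at $v_0$, with basis of topology the sets $\partial\mathcal T_v$ of those passing through $v$. A finite subtree $T\subset\mathcal T$ is complete if it contains $v_0$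 and, for every vertex of $T$ that is not a leaf, all its children lie in $T$; here a leaf of $T$ is a vertex with no child in $T$ and $\mathcal LT$ is the set of leaves. Put $\mathcal T\setminus T:=\bigsqcup_{v\in\mathcal LT}\mathcal T_v$. An honest almost automorphism is a forest isomorphism $\varphi:\mathcal T\setminus T_1\to\mathcal T\setminus T_2$ with $T_1,T_2$ finite complete subtrees. Two honest almost automorphisms with domains $\mathcal T\setminus T_1$, $\mathcal T\setminus T_1'$ are equivalent if they agree on $\mathcal T\setminus T$ for some finite complete subtree $T\supset T_1\cup T_1'$. The equivalence classes (almost automorphisms) form a group $\operatorname{AAut}(\mathcal T)$ by composing representatives with matching image and domain. $\operatorname{Aut}(\mathcal T)$ embeds in $\operatorname{AAut}(\mathcal T)$ by restricting automorphisms to complements of large finite complete subtrees. $\varphi:\mathcal T\setminus T_1\to\mathcal T\setminus T_2$ is $G$-honest if for every $v\in\mathcal LT_1$ there is $g_v\in G$ with $\varphi|_{\mathcal T_v}=g_v|_{\mathcal T_v}$; $\mathcal F(G)\le\operatorname{AAut}(\mathcal T)$ is the subgroup of classes of $G$-honest almost automorphisms, and it contains $G$. *)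

theory Defs
  imports "HOL-Analysis.Abstract_Topology" "HOL-Analysis.Product_Topology"
    "HOL-Algebra.Bij" "HOL-Algebra.Product_Groups"
begin

section \<open>Graphs and trees\<close>

text \<open>
  Simple undirected graphs, possibly infinite. The trees of the AFP entry Graph_Theory cannot be used:
  there an undirected edge is a pair of opposite arcs, and such a pair already counts as a cycle.
\<close>

record 'v ugraph =
  verts :: "'v set"
  edges :: "'v set set"

definition simple_graph :: "'v ugraph \<Rightarrow> bool" where
  "simple_graph T \<longleftrightarrow> edges T \<subseteq> {{u, v} |u v. u \<in> verts T \<and> v \<in> verts T \<and> u \<noteq> v}"

definition adj :: "'v ugraph \<Rightarrow> 'v \<Rightarrow> 'v \<Rightarrow> bool" where
  "adj T u v \<longleftrightarrow> {u, v} \<in> edges T"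

definition walk :: "'v ugraph \<Rightarrow> 'v \<Rightarrow> 'v list \<Rightarrow> 'v \<Rightarrow> bool" where
  "walk T u p v \<longleftrightarrow>
     p \<noteq> [] \<and> set p \<subseteq> verts T \<and> successively (adj T) p \<and> hd p = u \<and> last p = v"

definition cycle :: "'v ugraph \<Rightarrow> 'v list \<Rightarrow> bool" where
  "cycle T p \<longleftrightarrow> 3 \<le> length p \<and> distinct p \<and> walk T (hd p) p (last p) \<and> adj T (last p) (hd p)"

definition tree :: "'v ugraph \<Rightarrow> bool" where
  "tree T \<longleftrightarrow> simple_graph T \<and> verts T \<noteq> {} \<and>
     (\<forall>u\<in>verts T. \<forall>v\<in>verts T. \<exists>p. walk T u p v) \<and> (\<nexists>p. cycle T p)"

definition locally_finite :: "'v ugraph \<Rightarrow> bool" where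
  "locally_finite T \<longleftrightarrow> (\<forall>v\<in>verts T. finite {w. adj T v w})"

definition leafless :: "'v ugraph \<Rightarrow> bool" where
  "leafless T \<longleftrightarrow> (\<forall>v\<in>verts T. card {w. adj T v w} \<noteq> 1)"

text \<open>A subtree of a tree is the subgraph induced by its vertex set, so we represent it by that set.\<close>

definition subtree :: "'v ugraph \<Rightarrow> 'v set \<Rightarrow> bool" where
  "subtree T S \<longleftrightarrow> S \<noteq> {} \<and> S \<subseteq> verts T \<and>
     (\<forall>u\<in>S. \<forall>v\<in>S. \<exists>p. walk T u p v \<and> set p \<subseteq> S)"

definition spanned_subtree :: "'v ugraph \<Rightarrow> 'v set \<Rightarrow> 'v set" where
  "spanned_subtree T A = \<Inter>{S. subtree T S \<and> A \<subseteq> S}"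

definition gdist :: "'v ugraph \<Rightarrow> 'v \<Rightarrow> 'v \<Rightarrow> nat" where
  "gdist T u v = (LEAST n. \<exists>p. walk T u p v \<and> length p = Suc n)"

definition geodesic :: "'v ugraph \<Rightarrow> 'v \<Rightarrow> 'v list \<Rightarrow> 'v \<Rightarrow> bool" where
  "geodesic T u p v \<longleftrightarrow> walk T u p v \<and> length p = Suc (gdist T u v)"


section \<open>The automorphism group and its topology\<close>

text \<open>Isomorphisms are extensional, as in \<^const>\<open>Bij\<close>, so that equality of functions is equality of maps.\<close>

definition graph_iso :: "'v ugraph \<Rightarrow> 'v ugraph \<Rightarrow> ('v \<Rightarrow> 'v) set" where
  "graph_iso T T' = {f \<in> extensional (verts T). bij_betw f (verts T) (verts T') \<and>
     (\<forall>u\<in>verts T. \<forall>v\<in>verts T. adj T u v \<longleftrightarrow> adj T' (f u) (f v))}"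

definition Aut :: "'v ugraph \<Rightarrow> ('v \<Rightarrow> 'v) monoid" where
  "Aut T = (BijGroup (verts T)) \<lparr>carrier := graph_iso T T\<rparr>"

definition fixator :: "('v \<Rightarrow> 'v) set \<Rightarrow> 'v set \<Rightarrow> 'v set set \<Rightarrow> ('v \<Rightarrow> 'v) set" where
  "fixator G A B = {g \<in> G. (\<forall>v\<in>A. g v = v) \<and> (\<forall>e\<in>B. g ` e = e)}"

definition Aut_open :: "'v ugraph \<Rightarrow> ('v \<Rightarrow> 'v) set \<Rightarrow> bool" where
  "Aut_open T U \<longleftrightarrow> U \<subseteq> carrier (Aut T) \<and>
     (\<forall>g\<in>U. \<exists>A B. finite A \<and> A \<subseteq> verts T \<and> finite B \<and> B \<subseteq> edges T \<and>
        g <#\<^bsub>Aut T\<^esub> fixator (carrier (Aut T)) A B \<subseteq> U)"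

definition Aut_topology :: "'v ugraph \<Rightarrow> ('v \<Rightarrow> 'v) topology" where
  "Aut_topology T = topology (Aut_open T)"

lemma istopology_Aut_open: "istopology (Aut_open T)"
proof -
  let ?F = "fixator (carrier (Aut T))"
  have ex: "\<exists>A B. finite A \<and> A \<subseteq> verts T \<and> finite B \<and> B \<subseteq> edges T \<and> g <#\<^bsub>Aut T\<^esub> ?F A B \<subseteq> U"
    if "Aut_open T U" "g \<in> U" for g U
    using that by (simp add: Aut_open_def)
  have sub: "U \<subseteq> carrier (Aut T)" if "Aut_open T U" for U
    using that by (simp add: Aut_open_def)
  have coset_mono: "g <#\<^bsub>Aut T\<^esub> H \<subseteq> g <#\<^bsub>Aut T\<^esub> K" if "H \<subseteq> K" for g H K
    unfolding l_coset_def using that by (rule UN_mono) (rule subset_refl)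
  have F1: "?F (A \<union> A') (B \<union> B') \<subseteq> ?F A B" and F2: "?F (A \<union> A') (B \<union> B') \<subseteq> ?F A' B'"
    for A A' B B'
    unfolding fixator_def by (rule Collect_mono, simp)+
  have inter: "Aut_open T (U \<inter> W)" if U: "Aut_open T U" and W: "Aut_open T W" for U W
    unfolding Aut_open_def
  proof (intro conjI ballI)
    show "U \<inter> W \<subseteq> carrier (Aut T)"
      using sub[OF U] by (rule le_infI1)
    fix g assume g: "g \<in> U \<inter> W"
    from ex[OF U IntD1[OF g]] obtain A B where
      1: "finite A" "A \<subseteq> verts T" "finite B" "B \<subseteq> edges T" "g <#\<^bsub>Aut T\<^esub> ?F A B \<subseteq> U"
      by (elim exE conjE)
    from ex[OF W IntD2[OF g]] obtain A' B' where
      2: "finite A'" "A' \<subseteq> verts T" "finite B'" "B' \<subseteq> edges T" "g <#\<^bsub>Aut T\<^esub> ?F A' B' \<subseteq> W"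
      by (elim exE conjE)
    have "g <#\<^bsub>Aut T\<^esub> ?F (A \<union> A') (B \<union> B') \<subseteq> U \<inter> W"
      using order_trans[OF coset_mono[OF F1] 1(5)] order_trans[OF coset_mono[OF F2] 2(5)]
      by (rule Int_greatest)
    with 1 2 show "\<exists>A B. finite A \<and> A \<subseteq> verts T \<and> finite B \<and> B \<subseteq> edges T \<and> g <#\<^bsub>Aut T\<^esub> ?F A B \<subseteq> U \<inter> W"
      by (intro exI[of _ "A \<union> A'"] exI[of _ "B \<union> B'"]) simp
  qed
  have union: "Aut_open T (\<Union>\<K>)" if K: "\<forall>K\<in>\<K>. Aut_open T K" for \<K>
    unfolding Aut_open_def
  proof (intro conjI ballI)
    show "\<Union>\<K> \<subseteq> carrier (Aut T)"
      using K sub by (simp add: Sup_le_iff)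
    fix g assume "g \<in> \<Union>\<K>"
    then obtain U where U: "U \<in> \<K>" "g \<in> U" by (rule UnionE)
    from ex[OF K[rule_format, OF U(1)] U(2)] obtain A B where
      1: "finite A" "A \<subseteq> verts T" "finite B" "B \<subseteq> edges T" "g <#\<^bsub>Aut T\<^esub> ?F A B \<subseteq> U"
      by (elim exE conjE)
    have "g <#\<^bsub>Aut T\<^esub> ?F A B \<subseteq> \<Union>\<K>"
      using 1(5) Union_upper[OF U(1)] by (rule order_trans)
    with 1 show "\<exists>A B. finite A \<and> A \<subseteq> verts T \<and> finite B \<and> B \<subseteq> edges T \<and> g <#\<^bsub>Aut T\<^esub> ?F A B \<subseteq> \<Union>\<K>"
      by (intro exI[of _ A] exI[of _ B]) simp
  qed
  show ?thesis
    unfolding istopology_def by (simp add: inter union)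
qed

lemma openin_Aut_topology: "openin (Aut_topology T) U \<longleftrightarrow> Aut_open T U"
  unfolding Aut_topology_def by (simp only: topology_inverse'[OF istopology_Aut_open])


section \<open>Tits' Independence Property\<close>

text \<open>Paths are finite, infinite in one direction, or infinite in both directions.\<close>

definition is_path :: "'v ugraph \<Rightarrow> 'v set \<Rightarrow> bool" where
  "is_path T L \<longleftrightarrow> (\<exists>(I :: int set) p. I \<noteq> {} \<and> (\<forall>i\<in>I. \<forall>j\<in>I. {i..j} \<subseteq> I) \<and>
     p ` I \<subseteq> verts T \<and> inj_on p I \<and>
     (\<forall>i. i \<in> I \<and> i + 1 \<in> I \<longrightarrow> adj T (p i) (p (i + 1))) \<and> L = p ` I)"

text \<open>In a tree there is exactly one closest vertex.\<close>

definition proj :: "'v ugraph \<Rightarrow> 'v set \<Rightarrow> 'v \<Rightarrow> 'v" where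
  "proj T L v = (ARG_MIN (gdist T v) w. w \<in> L)"

definition path_branch :: "'v ugraph \<Rightarrow> 'v set \<Rightarrow> 'v \<Rightarrow> 'v set" where
  "path_branch T L w = spanned_subtree T {v \<in> verts T. proj T L v = w}"

text \<open>
  An automorphism fixing all vertices of \<open>L\<close> also fixes the edges between them, hence the
  empty edge set in \<open>fixator G L {}\<close>.
\<close>

definition tits_independence :: "'v ugraph \<Rightarrow> ('v \<Rightarrow> 'v) set \<Rightarrow> bool" where
  "tits_independence T G \<longleftrightarrow> (\<forall>L. is_path T L \<longrightarrow>
     (\<lambda>g. \<lambda>w\<in>L. restrict g (path_branch T L w)) \<in>
       iso ((Aut T)\<lparr>carrier := fixator G L {}\<rparr>)
         (product_group L (\<lambda>w. (BijGroup (path_branch T L w))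
            \<lparr>carrier := (\<lambda>g. restrict g (path_branch T L w)) ` fixator G L {}\<rparr>)))"


section \<open>Rooted trees and the boundary\<close>

definition children :: "'v ugraph \<Rightarrow> 'v \<Rightarrow> 'v \<Rightarrow> 'v set" where
  "children T r v = {w. adj T v w \<and> gdist T r v < gdist T r w}"

definition branch :: "'v ugraph \<Rightarrow> 'v \<Rightarrow> 'v \<Rightarrow> 'v set" where
  "branch T r v = {w \<in> verts T. \<exists>p. geodesic T r p w \<and> v \<in> set p}"

definition boundary :: "'v ugraph \<Rightarrow> 'v \<Rightarrow> (nat \<Rightarrow> 'v) set" where
  "boundary T r = {\<xi>. \<xi> 0 = r \<and> range \<xi> \<subseteq> verts T \<and> (\<forall>n. adj T (\<xi> n) (\<xi> (Suc n))) \<and>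
     (\<forall>m n. m \<le> n \<longrightarrow> gdist T (\<xi> m) (\<xi> n) = n - m)}"

definition boundary_topology :: "'v ugraph \<Rightarrow> 'v \<Rightarrow> (nat \<Rightarrow> 'v) topology" where
  "boundary_topology T r =
     topology_generated_by ((\<lambda>v. {\<xi> \<in> boundary T r. v \<in> range \<xi>}) ` verts T)"

definition no_isolated_boundary_points :: "'v ugraph \<Rightarrow> 'v \<Rightarrow> bool" where
  "no_isolated_boundary_points T r \<longleftrightarrow>
     (\<forall>\<xi>\<in>boundary T r. \<not> openin (boundary_topology T r) {\<xi>})"


section \<open>Almost automorphisms\<close>

text \<open>Leaves of \<open>S\<close> are taken in the rooted sense: \<open>r\<close> is a leaf of \<open>{r}\<close>.\<close>

definition leaves :: "'v ugraph \<Rightarrow> 'v \<Rightarrow> 'v set \<Rightarrow> 'v set" where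
  "leaves T r S = {v \<in> S. children T r v \<inter> S = {}}"

definition complete_subtree :: "'v ugraph \<Rightarrow> 'v \<Rightarrow> 'v set \<Rightarrow> bool" where
  "complete_subtree T r S \<longleftrightarrow> finite S \<and> subtree T S \<and> r \<in> S \<and>
     (\<forall>v\<in>S. v \<notin> leaves T r S \<longrightarrow> children T r v \<subseteq> S)"

text \<open>
  The forest \<open>\<T> \<setminus> S\<close>, the disjoint union of the branches at the leaves of \<open>S\<close>.
  It contains the leaves of \<open>S\<close>; in particular \<open>\<T> \<setminus> {r} = \<T>\<close>.
\<close>

definition forest_compl :: "'v ugraph \<Rightarrow> 'v \<Rightarrow> 'v set \<Rightarrow> 'v ugraph" where
  "forest_compl T r S =
     \<lparr>verts = (\<Union>v\<in>leaves T r S. branch T r v),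
      edges = (\<Union>v\<in>leaves T r S. {e \<in> edges T. e \<subseteq> branch T r v})\<rparr>"

text \<open>\<open>(S\<^sub>1, \<phi>, S\<^sub>2)\<close> stands for \<open>\<phi> : \<T> \<setminus> S\<^sub>1 \<rightarrow> \<T> \<setminus> S\<^sub>2\<close>.\<close>

type_synonym 'v aaut_rep = "'v set \<times> ('v \<Rightarrow> 'v) \<times> 'v set"

definition honest :: "'v ugraph \<Rightarrow> 'v \<Rightarrow> 'v aaut_rep set" where
  "honest T r = {(S\<^sub>1, \<phi>, S\<^sub>2). complete_subtree T r S\<^sub>1 \<and> complete_subtree T r S\<^sub>2 \<and>
     \<phi> \<in> graph_iso (forest_compl T r S\<^sub>1) (forest_compl T r S\<^sub>2)}"

definition aaut_rel :: "'v ugraph \<Rightarrow> 'v \<Rightarrow> 'v aaut_rep rel" where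
  "aaut_rel T r = {((S\<^sub>1, \<phi>, S\<^sub>2), (S\<^sub>1', \<phi>', S\<^sub>2')).
     (S\<^sub>1, \<phi>, S\<^sub>2) \<in> honest T r \<and> (S\<^sub>1', \<phi>', S\<^sub>2') \<in> honest T r \<and>
     (\<exists>S. complete_subtree T r S \<and> S\<^sub>1 \<union> S\<^sub>1' \<subseteq> S \<and>
        (\<forall>x\<in>verts (forest_compl T r S). \<phi> x = \<phi>' x))}"

text \<open>
  The embedding of \<open>Aut(\<T>)\<close>. All restrictions of an automorphism to complements of complete
  subtrees that are honest almost automorphisms are equivalent, so the union below is over a
  single class.
\<close>

definition aut_class :: "'v ugraph \<Rightarrow> 'v \<Rightarrow> ('v \<Rightarrow> 'v) \<Rightarrow> 'v aaut_rep set" where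
  "aut_class T r g = \<Union>{aaut_rel T r `` {(S\<^sub>1, restrict g (verts (forest_compl T r S\<^sub>1)), S\<^sub>2)} |S\<^sub>1 S\<^sub>2.
     (S\<^sub>1, restrict g (verts (forest_compl T r S\<^sub>1)), S\<^sub>2) \<in> honest T r}"

text \<open>
  The product of two classes composes representatives whose image and domain match; all choices
  of such representatives give the same class, so again the union is over a single class.
\<close>

definition AAut :: "'v ugraph \<Rightarrow> 'v \<Rightarrow> 'v aaut_rep set monoid" where
  "AAut T r =
     \<lparr>carrier = honest T r // aaut_rel T r,
      mult = (\<lambda>X Y. \<Union>{aaut_rel T r `` {(S\<^sub>1, compose (verts (forest_compl T r S\<^sub>1)) \<phi> \<psi>, S\<^sub>3)}
                |S\<^sub>1 S\<^sub>2 S\<^sub>3 \<phi> \<psi>. (S\<^sub>2, \<phi>, S\<^sub>3) \<in> X \<and> (S\<^sub>1, \<psi>, S\<^sub>2) \<in> Y}),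
      one = aut_class T r (\<one>\<^bsub>Aut T\<^esub>)\<rparr>"

definition G_honest :: "'v ugraph \<Rightarrow> 'v \<Rightarrow> ('v \<Rightarrow> 'v) set \<Rightarrow> 'v aaut_rep set" where
  "G_honest T r G = {(S\<^sub>1, \<phi>, S\<^sub>2) \<in> honest T r.
     \<forall>v\<in>leaves T r S\<^sub>1. \<exists>g\<in>G. \<forall>x\<in>branch T r v. \<phi> x = g x}"

definition \<F> :: "'v ugraph \<Rightarrow> 'v \<Rightarrow> ('v \<Rightarrow> 'v) set \<Rightarrow> 'v aaut_rep set monoid" where
  "\<F> T r G = (AAut T r)\<lparr>carrier := (\<lambda>\<phi>. aaut_rel T r `` {\<phi>}) ` G_honest T r G\<rparr>"


section \<open>Topological groups\<close>

locale topological_group = group H for H (structure) +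
  fixes \<tau>
  assumes topspace_eq: "topspace \<tau> = carrier H"
    and continuous_mult: "continuous_map (prod_topology \<tau> \<tau>) \<tau> (\<lambda>(x, y). x \<otimes> y)"
    and continuous_inv: "continuous_map \<tau> \<tau> (\<lambda>x. inv x)"

end

theory Submission
  imports Defs
begin

text \<open>
  An almost automorphism is determined by the germ of a representative modulo finite sets of
  vertices, so products and inverses in \<open>\<F>(G)\<close> are computed on germs. The images of the fixators
  \<open>Fix\<^sub>G(A)\<close>, \<open>A\<close> finite, must be a neighbourhood basis of the identity, which determines the topology;
  such a basis of open subgroups defines a group topology as soon as it is stable under conjugation.
  Let \<open>\<phi>\<close> agree with \<open>k\<^sub>v \<in> G\<close> on each of finitely many branches \<open>\<T>\<^sub>v\<close>, and let \<open>g \<in> G\<close> fix each \<open>v\<close> and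
  its parent. Tits' property for the edge above \<open>v\<close> provides \<open>g\<^sub>v \<in> G\<close> that agrees with \<open>g\<close> on \<open>\<T>\<^sub>v\<close> and is
  trivial elsewhere, and \<open>\<phi> g \<phi>\<inverse>\<close> is the class of the product of the elements \<open>k\<^sub>v g\<^sub>v k\<^sub>v\<inverse>\<close> of \<open>G\<close>.
\<close>

section \<open>Trees\<close>

text \<open>A product in \<open>AAut\<close> is formed from representatives whose image and domain
  match, whereas the trees of two given representatives are unrelated. Producing matching ones means
  shrinking domains, and the difficulty is that the image of the smaller forest must again be the
  complement of a complete subtree. Parent-closed sets \<open>I\<close> serve for this: the forest
  of \<open>thick I\<close> is \<open>V - I\<close>, and the complement of
  \<phi>(\<open>V - I\<close>) is again parent-closed once \<open>I\<close> contains the preimage of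
  the root. Restricting the left factor and the inverse of the right factor to one common
  \<open>V - I\<close> then makes them match.

  On the topological side, continuity of multiplication at (x, y) involves conjugation by y, and an
  element of \<F>(G) need not normalise G. A representative \<phi> uses different elements of G on
  different branches, so no single one of them conjugates g correctly everywhere; g has to be cut
  into branchwise pieces that still lie in G.\<close>

lemma walkD:
  assumes "walk T u p v"
  shows "p \<noteq> []" "set p \<subseteq> verts T" "successively (adj T) p" "hd p = u" "last p = v" "u \<in> set p" "v \<in> set p"
  using assms by (auto simp: walk_def)

lemma adj_sym: "adj T u v \<longleftrightarrow> adj T v u"
  by (simp add: adj_def insert_commute)

lemma walk_append:
  assumes "walk T u p v" "walk T v q w"
  shows "walk T u (p @ tl q) w"
proof (cases q)
  case (Cons a q')
  then have "a = v" using assms(2) by (auto simp: walk_def)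
  with Cons assms show ?thesis
    by (cases q') (auto simp: walk_def successively_append_iff split: if_splits)
qed (use assms in \<open>auto simp: walk_def\<close>)

lemma walk_rev:
  assumes "walk T u p v"
  shows "walk T v (rev p) u"
proof -
  have "successively (\<lambda>x y. adj T y x) p"
    using walkD(3)[OF assms] adj_sym[of T] by simp
  then show ?thesis
    using assms by (auto simp: walk_def hd_rev last_rev)
qed

lemma walk_take:
  assumes "walk T u p v" "i < length p"
  shows "walk T u (take (Suc i) p) (p ! i)"
proof -
  have "successively (adj T) (take (Suc i) p @ drop (Suc i) p)"
    using walkD(3)[OF assms(1)] by simp
  then have "successively (adj T) (take (Suc i) p)"
    by (simp only: successively_append_iff)
  moreover have "last (take (Suc i) p) = p ! i"
    using assms by (simp add: last_conv_nth take_Suc_conv_app_nth)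
  ultimately show ?thesis
    using assms set_take_subset[of "Suc i" p] by (auto simp: walk_def)
qed

lemma walk_distinct:
  assumes "walk T u p v"
  shows "\<exists>q. walk T u q v \<and> set q \<subseteq> set p \<and> distinct q"
  using assms
proof (induction p rule: length_induct)
  case (1 p)
  show ?case
  proof (cases "distinct p")
    case False
    then obtain xs ys zs y where p: "p = xs @ [y] @ ys @ [y] @ zs"
      using not_distinct_decomp by blast
    have "walk T u (xs @ [y] @ zs) v"
      using "1.prems" unfolding p by (auto simp: walk_def successively_append_iff successively_Cons hd_append split: if_splits)
    then show ?thesis
      using "1.IH"[rule_format, of "xs @ [y] @ zs"] p by fastforce
  qed (use 1 in auto)
qed

lemma successively_crosses:
  assumes "successively R p" "p \<noteq> []" "hd p \<notin> B" "last p \<in> B"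
  shows "\<exists>x y. x \<in> set p \<and> y \<in> set p \<and> R x y \<and> x \<notin> B \<and> y \<in> B"
  using assms
proof (induction p)
  case (Cons a p)
  show ?case
  proof (cases "p = [] \<or> hd p \<in> B")
    case True
    with Cons.prems show ?thesis
      by (cases p) (auto simp: successively_Cons)
  next
    case False
    with Cons show ?thesis
      by (auto simp: successively_Cons)
  qed
qed simp

text \<open>Applied to a set that only one edge enters, this forces every walk from outside through
  that edge.\<close>

lemma walk_crosses:
  assumes "walk T u p v" "u \<notin> B" "v \<in> B"
  shows "\<exists>x y. x \<in> set p \<and> y \<in> set p \<and> adj T x y \<and> x \<notin> B \<and> y \<in> B"
  using successively_crosses[of "adj T" p B] assms by (simp add: walk_def)

lemma gdist_le: "walk T u p v \<Longrightarrow> gdist T u v \<le> length p - 1"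
  unfolding gdist_def by (rule Least_le) (use walkD(1) in fastforce)

lemma geodesic_exists:
  assumes "walk T u p v"
  shows "\<exists>q. geodesic T u q v"
proof -
  have "\<exists>n q. walk T u q v \<and> length q = Suc n"
    using assms walkD(1) by (metis length_greater_0_conv Suc_pred)
  then show ?thesis
    unfolding geodesic_def gdist_def
    using LeastI_ex[of "\<lambda>n. \<exists>q. walk T u q v \<and> length q = Suc n"] by blast
qed

lemma gdist_geodesic_nth:
  assumes "geodesic T u p v" "i < length p"
  shows "gdist T u (p ! i) \<le> i"
  using gdist_le[OF walk_take[of T u p v i]] assms by (auto simp: geodesic_def)

lemma gdist_geodesic_less:
  assumes "geodesic T u p v" "x \<in> set p" "x \<noteq> v"
  shows "gdist T u x < gdist T u v"
proof -
  obtain i where i: "i < length p" "p ! i = x"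
    using assms(2) by (auto simp: in_set_conv_nth)
  have "p ! gdist T u v = v"
    using assms(1) last_conv_nth[of p] by (auto simp: geodesic_def walk_def)
  then have "i < gdist T u v"
    using i assms(1,3) by (auto simp: geodesic_def less_Suc_eq)
  then show ?thesis
    using gdist_geodesic_nth[OF assms(1) i(1)] i(2) by simp
qed

section \<open>Distance from the root and the parent of a vertex\<close>

locale rooted_tree =
  fixes T :: "'v ugraph" and r :: 'v
  assumes is_tree: "tree T" and root: "r \<in> verts T"
begin

abbreviation V where "V \<equiv> verts T"
abbreviation d where "d \<equiv> gdist T r"

lemma adjD: "adj T u v \<Longrightarrow> u \<in> V \<and> v \<in> V \<and> u \<noteq> v"
proof -
  assume "adj T u v"
  then have "{u, v} \<in> {{u, v} |u v. u \<in> V \<and> v \<in> V \<and> u \<noteq> v}"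
    using is_tree by (auto simp: tree_def simple_graph_def adj_def)
  then show ?thesis by (auto simp: doubleton_eq_iff)
qed

lemma connected: "u \<in> V \<Longrightarrow> v \<in> V \<Longrightarrow> \<exists>p. geodesic T u p v"
proof -
  assume "u \<in> V" "v \<in> V"
  then obtain p where "walk T u p v"
    using is_tree unfolding tree_def by meson
  then show ?thesis by (rule geodesic_exists)
qed

text \<open>Acyclicity enters here: a repetition-free walk between two different neighbours of
  \<open>v\<close> that avoids \<open>v\<close> becomes a cycle when \<open>v\<close> is put in
  front.\<close>

lemma no_bypass:
  assumes "adj T v u" "adj T v u'" "walk T u p u'" "v \<notin> set p"
  shows "u = u'"
proof (rule ccontr)
  assume neq: "u \<noteq> u'"
  obtain q where q: "walk T u q u'" "set q \<subseteq> set p" "distinct q"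
    using walk_distinct[OF assms(3)] by blast
  \<comment> \<open>With \<open>v\<close> in front the list has the three vertices that
    \<open>cycle\<close> demands.\<close>
  have "2 \<le> length q"
    using q(1) neq by (cases q rule: remdups_adj.cases) (auto simp: walk_def)
  then have "cycle T (v # q)"
    using q assms adjD[OF assms(1)] neq
    by (auto simp: cycle_def walk_def successively_Cons adj_sym)
  then show False
    using is_tree by (auto simp: tree_def)
qed

text \<open>A geodesic from \<open>r\<close> to a neighbour of \<open>v\<close> that is no farther
  than \<open>v\<close> avoids \<open>v\<close>, so two such neighbours are joined by a walk around
  \<open>v\<close>. The inequalities are not strict, in order to exclude edges between vertices at
  equal distance as well.\<close>

lemma lower_neighbour_unique:
  assumes u: "adj T v u" "d u \<le> d v" and u': "adj T v u'" "d u' \<le> d v"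
  shows "u = u'"
proof -
  have avoid: "\<exists>p. walk T r p w \<and> v \<notin> set p" if w: "adj T v w" "d w \<le> d v" for w
  proof -
    obtain p where p: "geodesic T r p w"
      using connected root adjD[OF w(1)] by blast
    then have "v \<notin> set p"
      using gdist_geodesic_less[OF p, of v] w adjD[OF w(1)] by auto
    then show ?thesis using p by (auto simp: geodesic_def)
  qed
  obtain p p' where p: "walk T r p u" "v \<notin> set p" "walk T r p' u'" "v \<notin> set p'"
    using avoid[OF u] avoid[OF u'] by blast
  show ?thesis
    using no_bypass[OF u(1) u'(1) walk_append[OF walk_rev[OF p(1)] p(3)]] p(2,4)
      list.set_sel(2)[of p'] walkD(1)[OF p(3)] by auto
qed

lemma d_root: "d r = 0"
  using gdist_le[of T r "[r]" r] root by (simp add: walk_def)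

lemma d_eq_0: "v \<in> V \<Longrightarrow> d v = 0 \<longleftrightarrow> v = r"
  using connected[of r v] root d_root by (auto simp: geodesic_def walk_def length_Suc_conv)

lemma lower_neighbour_exists:
  assumes "v \<in> V" "v \<noteq> r"
  shows "\<exists>u. adj T v u \<and> d u < d v"
proof -
  obtain p where p: "geodesic T r p v"
    using connected root assms by blast
  define q where "q = butlast p"
  have pq: "p = q @ [v]"
    using p append_butlast_last_id[of p] by (auto simp: geodesic_def walk_def q_def)
  have "q \<noteq> []"
    using p assms unfolding pq by (auto simp: geodesic_def walk_def)
  then have "adj T (last q) v"
    using p unfolding pq by (auto simp: geodesic_def walk_def successively_append_iff)
  then show ?thesis
    using gdist_geodesic_less[OF p, of "last q"] \<open>q \<noteq> []\<close> adj_sym adjD by (fastforce simp: pq)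
qed

text \<open>At \<open>r\<close> there is no lower neighbour and the value is arbitrary, hence the
  side condition \<open>v \<noteq> r\<close> in what follows.\<close>

definition parent :: "'v \<Rightarrow> 'v" where
  "parent v = (SOME u. adj T v u \<and> d u < d v)"

lemma parent:
  assumes "v \<in> V" "v \<noteq> r"
  shows "adj T v (parent v)" "adj T (parent v) v" "d (parent v) < d v" "parent v \<in> V" "parent v \<noteq> v"
proof -
  show *: "adj T v (parent v)" "d (parent v) < d v"
    using someI_ex[OF lower_neighbour_exists[OF assms]] unfolding parent_def by auto
  show "adj T (parent v) v" using * by (simp add: adj_sym)
  show "parent v \<in> V" "parent v \<noteq> v" using adjD[OF *(1)] by auto
qed

text \<open>Compare the distances of both ends: by uniqueness, the end that is no farther from
  \<open>r\<close> is the parent of the other.\<close>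

lemma adj_cases:
  assumes "adj T u v"
  obtains "v \<noteq> r" "u = parent v" | "u \<noteq> r" "v = parent u"
proof -
  have *: "w \<noteq> r \<and> x = parent w" if "adj T x w" "d x \<le> d w" for x w
  proof -
    have "w \<noteq> r"
      using that adjD d_root d_eq_0 by fastforce
    then show ?thesis
      using lower_neighbour_unique[of w x "parent w"] that parent[of w] adjD[OF that(1)] adj_sym[of T w x] by auto
  qed
  show thesis
    using *[of u v] *[of v u] assms adj_sym[of T u v] that by (meson linear)
qed

lemma vertex_induct [consumes 1, case_names base step]:
  assumes "v \<in> V" "P r" "\<And>v. v \<in> V \<Longrightarrow> v \<noteq> r \<Longrightarrow> P (parent v) \<Longrightarrow> P v"
  shows "P v"
  using assms(1)
proof (induction "d v" arbitrary: v rule: less_induct)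
  case less
  show ?case
    using less assms(2,3) parent[of v] by (cases "v = r") auto
qed

lemma children_iff: "w \<in> children T r v \<longleftrightarrow> w \<in> V \<and> w \<noteq> r \<and> parent w = v"
proof
  assume "w \<in> children T r v"
  then have w: "adj T v w" "d v < d w" by (auto simp: children_def)
  from w(1) show "w \<in> V \<and> w \<noteq> r \<and> parent w = v"
    using adjD[OF w(1)] w(2) parent[of v] by (elim adj_cases) auto
qed (use parent in \<open>auto simp: children_def\<close>)

section \<open>Geodesics from the root and the branches of the tree\<close>

lemma geodesic_root_iff: "geodesic T r p r \<longleftrightarrow> p = [r]"
  using root d_root by (auto simp: geodesic_def walk_def length_Suc_conv)

lemma d_parent: "v \<in> V \<Longrightarrow> v \<noteq> r \<Longrightarrow> d v = Suc (d (parent v))"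
proof -
  assume v: "v \<in> V" "v \<noteq> r"
  obtain p where p: "geodesic T r p (parent v)"
    using connected root parent[OF v] by blast
  have "walk T r (p @ tl [parent v, v]) v"
    by (rule walk_append) (use p v parent[OF v] in \<open>auto simp: geodesic_def walk_def\<close>)
  from gdist_le[OF this] show ?thesis
    using p parent(3)[OF v] by (auto simp: geodesic_def)
qed

text \<open>The vertex before \<open>v\<close> on a geodesic is a lower neighbour, that is, the
  parent. With \<open>geodesic_root_iff\<close> this makes geodesics from the root unique and turns
  \<open>branch\<close> into a recursion over ancestors.\<close>

lemma geodesic_step_iff:
  assumes "v \<in> V" "v \<noteq> r"
  shows "geodesic T r p v \<longleftrightarrow> (\<exists>q. p = q @ [v] \<and> geodesic T r q (parent v))"
proof
  assume p: "geodesic T r p v"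
  define q where "q = butlast p"
  have pq: "p = q @ [v]"
    using p append_butlast_last_id[of p] by (auto simp: geodesic_def walk_def q_def)
  have q: "q \<noteq> []"
    using p assms unfolding pq by (auto simp: geodesic_def walk_def)
  then have "adj T (last q) v"
    using p unfolding pq by (auto simp: geodesic_def walk_def successively_append_iff)
  moreover have "d (last q) < d v"
    using gdist_geodesic_less[OF p, of "last q"] q adjD[OF calculation] by (auto simp: pq)
  ultimately have "last q = parent v"
    by (elim adj_cases) (use parent[of "last q"] adjD[OF \<open>adj T (last q) v\<close>] in auto)
  then have "geodesic T r q (parent v)"
    using p q d_parent[OF assms] unfolding pq
    by (auto simp: geodesic_def walk_def successively_append_iff)
  then show "\<exists>q. p = q @ [v] \<and> geodesic T r q (parent v)"
    using pq by blast
next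
  assume "\<exists>q. p = q @ [v] \<and> geodesic T r q (parent v)"
  then show "geodesic T r p v"
    using parent[OF assms] assms d_parent[OF assms]
    by (auto simp: geodesic_def walk_def successively_append_iff)
qed

lemma branch_iff: "w \<in> branch T r v \<longleftrightarrow> w \<in> V \<and> (w = v \<or> w \<noteq> r \<and> parent w \<in> branch T r v)"
proof (cases "w \<in> V \<and> w \<noteq> r")
  case True
  then show ?thesis
    using parent[of w] connected[OF root, of "parent w"]
    by (auto simp: branch_def geodesic_step_iff walkD)
next
  case False
  then show ?thesis
    using root geodesic_root_iff[of "[r]"] by (fastforce simp: branch_def geodesic_root_iff)
qed

lemma branch_subset: "branch T r v \<subseteq> V"
  by (auto simp: branch_def)

lemma branch_self: "v \<in> V \<Longrightarrow> v \<in> branch T r v"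
  using branch_iff[of v v] by simp

lemma branch_root: "branch T r r = V"
proof -
  have "v \<in> branch T r r" if "v \<in> V" for v
    using that
  proof (induction rule: vertex_induct)
    case (step x)
    then show ?case using branch_iff[of x r] by blast
  qed (rule branch_self[OF root])
  then show ?thesis using branch_subset by blast
qed

lemma branch_trans:
  assumes "w \<in> branch T r u" "u \<in> branch T r v"
  shows "w \<in> branch T r v"
proof -
  have "w \<in> V" using assms branch_subset by auto
  then show ?thesis using assms
  proof (induction rule: vertex_induct)
    case (step x)
    then show ?case
      using branch_iff[of x u] branch_iff[of x v] by blast
  qed (use branch_iff[of r u] branch_iff[of r v] in blast)
qed

lemma d_branch:
  assumes "w \<in> branch T r v"
  shows "w = v \<or> d v < d w"
proof -
  have "w \<in> V" using assms branch_subset by auto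
  then show ?thesis using assms
  proof (induction rule: vertex_induct)
    case (step x)
    then show ?case
      using branch_iff[of x v] parent(3)[of x] by force
  qed (use branch_iff[of r v] in blast)
qed

lemma root_branch: "r \<in> branch T r v \<longleftrightarrow> v = r"
  using root branch_iff[of r v] by blast

lemma parent_branch: "v \<in> V \<Longrightarrow> v \<noteq> r \<Longrightarrow> parent v \<notin> branch T r v"
  using d_branch[of "parent v" v] parent[of v] by auto

text \<open>Every edge joins a vertex to its parent. A child of a member stays inside, and a member
  other than \<open>v\<close> has its parent inside.\<close>

lemma branch_crossing:
  assumes "adj T x y" "x \<in> branch T r v" "y \<notin> branch T r v"
  shows "x = v \<and> v \<noteq> r \<and> y = parent v"
  using assms(1)
proof (cases rule: adj_cases)
  case 1
  then have "y \<in> branch T r v"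
    using assms(2) adjD[OF assms(1)] branch_iff[of y v] by blast
  then show ?thesis using assms(3) by blast
next
  case 2
  then have "x = v"
    using assms(2,3) branch_iff[of x v] by blast
  with 2 show ?thesis by blast
qed

text \<open>The ancestors of a vertex form a chain; hence two branches are nested or
  disjoint.\<close>

lemma branch_comparable:
  assumes "w \<in> branch T r u" "w \<in> branch T r v"
  shows "u \<in> branch T r v \<or> v \<in> branch T r u"
proof -
  have "w \<in> V" using assms branch_subset by auto
  then show ?thesis using assms
  proof (induction rule: vertex_induct)
    case (step x)
    then show ?case
      using branch_iff[of x u] branch_iff[of x v] by blast
  qed (use branch_iff[of r u] branch_iff[of r v] in blast)
qed

text \<open>Cutting a walk at the only edge that leaves a branch.\<close>

lemma gdist_branch_less:
  assumes "v \<in> V" "v \<noteq> r" "x \<in> V"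
  shows "x \<in> branch T r v \<Longrightarrow> gdist T x v < gdist T x (parent v)"
    and "x \<notin> branch T r v \<Longrightarrow> gdist T x (parent v) < gdist T x v"
proof -
  note par = parent[OF assms(1,2)]
  { assume x: "x \<in> branch T r v"
    obtain p where p: "geodesic T x p (parent v)"
      using connected assms par by blast
    have "v \<in> set p"
      using walk_crosses[of T x p "parent v" "- branch T r v"] x p parent_branch[OF assms(1,2)]
        branch_crossing by (auto simp: geodesic_def)
    then show "gdist T x v < gdist T x (parent v)"
      using gdist_geodesic_less[OF p] par by auto }
  { assume x: "x \<notin> branch T r v"
    obtain p where p: "geodesic T x p v"
      using connected assms par by blast
    have "parent v \<in> set p"
      using walk_crosses[of T x p v "branch T r v"] x p branch_self[OF assms(1)]
        branch_crossing adj_sym[of T] by (fastforce simp: geodesic_def)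
    then show "gdist T x (parent v) < gdist T x v"
      using gdist_geodesic_less[OF p] par by auto }
qed

end

section \<open>Complete subtrees and their complements\<close>

context rooted_tree
begin

text \<open>These are the subtrees containing \<open>r\<close> (\<open>subtree_rooted\<close>,
  \<open>rooted_subtree\<close>); closure under parents is the form that suits
  \<open>vertex_induct\<close>.\<close>

definition rooted :: "'v set \<Rightarrow> bool" where
  "rooted I \<longleftrightarrow> I \<subseteq> V \<and> r \<in> I \<and> (\<forall>v\<in>I. v \<noteq> r \<longrightarrow> parent v \<in> I)"

text \<open>The branch at \<open>v\<close> can be entered only from \<open>parent v\<close>, so a
  walk from \<open>r\<close> to \<open>v\<close> inside \<open>S\<close> visits
  \<open>parent v\<close>.\<close>

lemma subtree_rooted:
  assumes "subtree T S" "r \<in> S"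
  shows "rooted S"
proof -
  have "parent v \<in> S" if v: "v \<in> S" "v \<noteq> r" for v
  proof -
    have vV: "v \<in> V" using assms v by (auto simp: subtree_def)
    obtain p where p: "walk T r p v" "set p \<subseteq> S"
      using assms v unfolding subtree_def by meson
    obtain x y where "x \<in> set p" "adj T x y" "x \<notin> branch T r v" "y \<in> branch T r v"
      using walk_crosses[OF p(1), of "branch T r v"] root_branch[of v] v branch_self[OF vV] by blast
    then show ?thesis
      using branch_crossing[of y x v] adj_sym[of T x y] p(2) by blast
  qed
  then show ?thesis
    using assms by (auto simp: rooted_def subtree_def)
qed

lemma rooted_subtree:
  assumes "rooted I"
  shows "subtree T I"
proof -
  have *: "\<exists>p. walk T r p v \<and> set p \<subseteq> I" if "v \<in> V" "v \<in> I" for v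
    using that
  proof (induction rule: vertex_induct)
    case base
    then show ?case using root by (intro exI[of _ "[r]"]) (auto simp: walk_def)
  next
    case (step v)
    then obtain p where p: "walk T r p (parent v)" "set p \<subseteq> I"
      using assms unfolding rooted_def by blast
    have "walk T (parent v) [parent v, v] v"
      using parent[OF step(1,2)] step by (auto simp: walk_def)
    from walk_append[OF p(1) this] show ?case
      using p(2) step by (intro exI[of _ "p @ [v]"]) auto
  qed
  have "\<exists>p. walk T u p v \<and> set p \<subseteq> I" if uv: "u \<in> I" "v \<in> I" for u v
  proof -
    obtain p q where p: "walk T r p u" "set p \<subseteq> I" and q: "walk T r q v" "set q \<subseteq> I"
      using *[of u] *[of v] uv assms by (auto simp: rooted_def)
    show ?thesis
      using walk_append[OF walk_rev[OF p(1)] q(1)] p(2) q(2) walkD(1)[OF q(1)] list.set_sel(2)[of q]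
      by (intro exI[of _ "rev p @ tl q"]) auto
  qed
  then show ?thesis
    using assms by (auto simp: subtree_def rooted_def)
qed

lemma rooted_branch:
  assumes "rooted I" "x \<in> I" "x \<in> branch T r v"
  shows "v \<in> I"
proof -
  have "x \<in> V" using assms branch_subset by auto
  then show ?thesis using assms(2,3)
  proof (induction rule: vertex_induct)
    case (step x)
    then show ?case
      using branch_iff[of x v] assms(1) unfolding rooted_def by blast
  qed (use branch_iff[of r v] in blast)
qed

lemma finite_ancestors: "v \<in> V \<Longrightarrow> finite {u. v \<in> branch T r u}"
proof (induction rule: vertex_induct)
  case base
  then show ?case by (simp add: root_branch)
next
  case (step v)
  then have "v \<in> branch T r u \<longleftrightarrow> u = v \<or> parent v \<in> branch T r u" for u
    using branch_iff[of v u] by blast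
  then have "{u. v \<in> branch T r u} = insert v {u. parent v \<in> branch T r u}"
    by auto
  then show ?case using step by simp
qed

text \<open>Adding all ancestors of the members of \<open>D\<close> keeps the set finite, because
  each vertex has finitely many. The explicit \<open>r\<close> is for empty
  \<open>D\<close>.\<close>

lemma rooted_cover:
  assumes "finite D" "D \<subseteq> V"
  shows "\<exists>I. finite I \<and> rooted I \<and> D \<subseteq> I"
proof (intro exI conjI)
  let ?I = "insert r (\<Union>x\<in>D. {u \<in> V. x \<in> branch T r u})"
  show "finite ?I"
    using assms finite_ancestors by (auto intro: finite_subset)
  show "D \<subseteq> ?I" using assms branch_self by auto
  have "parent u \<in> ?I" if u: "u \<in> ?I" "u \<noteq> r" for u
  proof -
    obtain x where x: "x \<in> D" "u \<in> V" "x \<in> branch T r u"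
      using u by blast
    have "u \<in> branch T r (parent u)"
      using branch_iff[of u "parent u"] branch_self[of "parent u"] parent[OF x(2) u(2)] x u by blast
    then show ?thesis
      using branch_trans[OF x(3)] x parent(4)[OF x(2) u(2)] by blast
  qed
  then show "rooted ?I" using root by (auto simp: rooted_def)
qed

lemma branch_child:
  assumes "x \<in> branch T r v" "x \<noteq> v"
  shows "\<exists>c\<in>children T r v. x \<in> branch T r c"
proof -
  have "x \<in> V" using assms branch_subset by auto
  then show ?thesis using assms
  proof (induction rule: vertex_induct)
    case base
    then show ?case using branch_iff[of r v] by blast
  next
    case (step x)
    then have p: "parent x \<in> branch T r v"
      using branch_iff[of x v] by blast
    show ?case
    proof (cases "parent x = v")
      case True
      then show ?thesis
        using step children_iff[of x v] branch_self[OF step(1)] by blast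
    next
      case False
      then show ?thesis
        using step p branch_iff by metis
    qed
  qed
qed

lemma complete_rooted: "complete_subtree T r S \<Longrightarrow> rooted S"
  using subtree_rooted by (auto simp: complete_subtree_def)

abbreviation F where "F S \<equiv> verts (forest_compl T r S)"

lemma F_iff: "x \<in> F S \<longleftrightarrow> (\<exists>v\<in>leaves T r S. x \<in> branch T r v)"
  by (simp add: forest_compl_def)

lemma F_subset: "F S \<subseteq> V"
  using branch_subset by (auto simp: forest_compl_def)

text \<open>Climb from \<open>x\<close> to the first parent inside \<open>S\<close>. It has a child
  outside \<open>S\<close>, and completeness makes such a vertex a leaf.\<close>

lemma V_subset_F:
  assumes "complete_subtree T r S" "x \<in> V" "x \<notin> S"
  shows "x \<in> F S"
  using assms(2,3)
proof (induction rule: vertex_induct)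
  case base
  then show ?case using complete_rooted[OF assms(1)] by (simp add: rooted_def)
next
  case (step x)
  show ?case
  proof (cases "parent x \<in> S")
    case True
    moreover have "x \<in> children T r (parent x)"
      using step by (simp add: children_iff)
    ultimately have "parent x \<in> leaves T r S"
      using assms(1) step by (auto simp: complete_subtree_def)
    then show ?thesis
      using branch_iff[of x "parent x"] step branch_self[of "parent x"] parent[of x] by (auto simp: F_iff)
  next
    case False
    then show ?thesis
      using step branch_iff[of x] F_iff by metis
  qed
qed

lemma finite_compl_F: "complete_subtree T r S \<Longrightarrow> finite (V - F S)"
  using V_subset_F[of S] by (auto simp: complete_subtree_def intro: finite_subset[of _ S])

text \<open>An edge could leave a leaf branch only upwards from the leaf \<open>v\<close> itself.
  Then the parent of \<open>v\<close> lies in \<open>S\<close> without being a leaf, and such a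
  vertex is in no leaf branch.\<close>

lemma forest_edge_in_branch:
  assumes "complete_subtree T r S" "u \<in> F S" "v \<in> F S" "v \<noteq> r" "u = parent v"
  shows "\<exists>w\<in>leaves T r S. u \<in> branch T r w \<and> v \<in> branch T r w"
proof -
  obtain w where w: "w \<in> leaves T r S" "v \<in> branch T r w"
    using assms by (auto simp: F_iff)
  obtain w' where w': "w' \<in> leaves T r S" "u \<in> branch T r w'"
    using assms by (auto simp: F_iff)
  have S: "rooted S" using complete_rooted assms by blast
  have vV: "v \<in> V" using assms F_subset by auto
  show ?thesis
  proof (cases "v = w")
    case True
    have "u \<in> S"
      using S w(1) assms(4,5) True by (auto simp: rooted_def leaves_def)
    have "v \<in> children T r u"
      using vV assms by (simp add: children_iff)
    then have "u \<notin> leaves T r S"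
      using w(1) True by (auto simp: leaves_def)
    then have "u \<noteq> w'" using w' by auto
    obtain c where "c \<in> children T r w'" "u \<in> branch T r c"
      using branch_child[OF w'(2) \<open>u \<noteq> w'\<close>] by blast
    then have "c \<in> S" using rooted_branch[OF S \<open>u \<in> S\<close>] by blast
    then show ?thesis
      using w'(1) \<open>c \<in> children T r w'\<close> by (auto simp: leaves_def)
  next
    case False
    then show ?thesis
      using w branch_iff[of v w] assms by blast
  qed
qed

text \<open>The forest is thus an induced subgraph, and isomorphisms of forests can be treated as
  bijections that preserve and reflect \<open>adj T\<close>.\<close>

lemma adj_forest:
  assumes "complete_subtree T r S" "u \<in> F S" "v \<in> F S"
  shows "adj (forest_compl T r S) u v \<longleftrightarrow> adj T u v"
proof
  assume "adj T u v"
  moreover have "\<exists>w\<in>leaves T r S. u \<in> branch T r w \<and> v \<in> branch T r w"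
    using \<open>adj T u v\<close>
    by (cases rule: adj_cases) (use forest_edge_in_branch assms in blast)+
  ultimately show "adj (forest_compl T r S) u v"
    by (auto simp: adj_def forest_compl_def)
qed (auto simp: adj_def forest_compl_def)

end

section \<open>Leafless trees and their exhaustion by complete subtrees\<close>

locale leafless_tree = rooted_tree T r for T :: "'v ugraph" and r +
  assumes loc_finite: "locally_finite T" and no_leaves: "leafless T"
begin

lemma finite_children: "v \<in> V \<Longrightarrow> finite (children T r v)"
  using loc_finite by (auto simp: locally_finite_def children_def)

text \<open>\<open>leafless\<close> forbids degree one, so a vertex with a parent has a further
  neighbour. The root has a child unless the tree is a single vertex, whose degree zero
  \<open>leafless\<close> allows.\<close>

lemma has_child:
  assumes "V \<noteq> {r}" "v \<in> V"
  shows "\<exists>w. w \<in> children T r v"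
proof (cases "v = r")
  case True
  show ?thesis
  proof (rule ccontr)
    assume no: "\<nexists>w. w \<in> children T r v"
    have "x = r" if "x \<in> V" for x
      using that
    proof (induction rule: vertex_induct)
      case (step x)
      then show ?case using no True children_iff[of x r] by blast
    qed simp
    then show False using assms root by blast
  qed
next
  case False
  note par = parent[OF assms(2) False]
  have "{w. adj T v w} \<noteq> {parent v}"
    using no_leaves assms unfolding leafless_def by (metis is_singletonI is_singleton_altdef)
  then obtain w where w: "adj T v w" "w \<noteq> parent v"
    using par by auto
  from w(1) have "w \<in> children T r v"
    by (cases rule: adj_cases) (use w adjD[OF w(1)] in \<open>auto simp: children_iff\<close>)
  then show ?thesis by blast
qed

text \<open>\<open>forest_compl\<close> keeps the leaves of the complete subtree. One added layer of
  children places the leaves just outside a parent-closed \<open>I\<close>, so that the forest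
  becomes exactly \<open>V - I\<close> (\<open>F_thick\<close>).\<close>

definition thick :: "'v set \<Rightarrow> 'v set" where
  "thick I = I \<union> (\<Union>v\<in>I. children T r v)"

lemma leaves_thick:
  assumes "V \<noteq> {r}" "rooted I"
  shows "leaves T r (thick I) = {v \<in> V. v \<notin> I \<and> v \<noteq> r \<and> parent v \<in> I}"
proof -
  have IV: "I \<subseteq> V" and rI: "r \<in> I" using assms by (auto simp: rooted_def)
  have "v \<notin> leaves T r (thick I)" if "v \<in> I" for v
    using has_child[OF assms(1), of v] that IV by (auto simp: leaves_def thick_def)
  moreover have "v \<in> leaves T r (thick I) \<longleftrightarrow> v \<in> thick I" if "v \<notin> I" for v
    using that assms(2) by (auto simp: leaves_def thick_def children_iff rooted_def)
  ultimately show ?thesis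
    using IV rI by (auto simp: thick_def children_iff)
qed

lemma complete_thick:
  assumes "V \<noteq> {r}" "finite I" "rooted I"
  shows "complete_subtree T r (thick I)"
proof -
  have "rooted (thick I)"
    using assms(3) by (auto simp: rooted_def thick_def children_iff)
  moreover have "finite (thick I)"
    using assms finite_children by (auto simp: thick_def rooted_def)
  moreover have "children T r v \<subseteq> thick I" if "v \<in> thick I" "v \<notin> leaves T r (thick I)" for v
    using that unfolding leaves_thick[OF assms(1,3)] using assms(3)
    by (auto simp: thick_def children_iff rooted_def)
  ultimately show ?thesis
    using rooted_subtree by (auto simp: complete_subtree_def rooted_def)
qed

text \<open>Climb from \<open>x\<close> until the parent lies in \<open>I\<close>. Together with
  \<open>rooted_branch\<close> this decomposes \<open>V - I\<close> into the branches at the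
  vertices just below \<open>I\<close>.\<close>

lemma boundary_branch:
  assumes "rooted I" "x \<in> V" "x \<notin> I"
  shows "\<exists>v\<in>V. v \<notin> I \<and> v \<noteq> r \<and> parent v \<in> I \<and> x \<in> branch T r v"
  using assms(2,3)
proof (induction rule: vertex_induct)
  case base
  then show ?case using assms(1) by (simp add: rooted_def)
next
  case (step x)
  show ?case
  proof (cases "parent x \<in> I")
    case True
    then show ?thesis using step branch_self[OF step(1)] by blast
  next
    case False
    then show ?thesis using step branch_iff by metis
  qed
qed

lemma F_thick:
  assumes "V \<noteq> {r}" "rooted I"
  shows "F (thick I) = V - I"
  unfolding set_eq_iff F_iff leaves_thick[OF assms]
  using boundary_branch[OF assms(2)] rooted_branch[OF assms(2)] branch_subset by fastforce

text \<open>Fails for the one-vertex tree, where instead all honest almost automorphisms coincide.\<close>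

lemma complete_cofinite:
  assumes "V \<noteq> {r}" "finite D" "D \<subseteq> V"
  shows "\<exists>S. complete_subtree T r S \<and> D \<subseteq> S \<and> F S \<inter> D = {}"
proof -
  obtain I where "finite I" "rooted I" "D \<subseteq> I"
    using rooted_cover[OF assms(2,3)] by blast
  then show ?thesis
    using complete_thick[OF assms(1)] F_thick[OF assms(1)]
    by (intro exI[of _ "thick I"]) (auto simp: thick_def)
qed

end

section \<open>Almost automorphisms as germs\<close>

lemma graph_isoD:
  assumes "g \<in> graph_iso T T'"
  shows "g \<in> extensional (verts T)" "bij_betw g (verts T) (verts T')" "inj_on g (verts T)"
    "g ` verts T = verts T'" "x \<in> verts T \<Longrightarrow> g x \<in> verts T'"
    "\<lbrakk>x \<in> verts T; y \<in> verts T\<rbrakk> \<Longrightarrow> adj T' (g x) (g y) \<longleftrightarrow> adj T x y"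
  using assms by (auto simp: graph_iso_def bij_betw_def)

lemma graph_iso_compose:
  assumes "g \<in> graph_iso T' T''" "h \<in> graph_iso T T'"
  shows "compose (verts T) g h \<in> graph_iso T T''"
  using assms bij_betw_compose[of h "verts T" "verts T'" g "verts T''"] graph_isoD(5)[OF assms(2)]
  by (auto simp: graph_iso_def compose_eq)

lemma graph_iso_inverse:
  assumes "g \<in> graph_iso T T'"
  shows "restrict (inv_into (verts T) g) (verts T') \<in> graph_iso T' T"
proof -
  note g = graph_isoD[OF assms]
  have "bij_betw (inv_into (verts T) g) (verts T') (verts T)"
    by (rule bij_betw_inv_into[OF g(2)])
  moreover have "adj T (inv_into (verts T) g u) (inv_into (verts T) g v) \<longleftrightarrow> adj T' u v"
    if "u \<in> verts T'" "v \<in> verts T'" for u v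
    using that g(6)[of "inv_into (verts T) g u" "inv_into (verts T) g v"] g(4)
    by (simp add: inv_into_into f_inv_into_f)
  ultimately show ?thesis
    by (simp add: graph_iso_def bij_betw_def inj_on_def)
qed

lemma group_Aut: "group (Aut T)"
proof -
  have Bij: "graph_iso T T \<subseteq> Bij (verts T)"
    by (auto simp: graph_iso_def Bij_def)
  interpret B: group "BijGroup (verts T)" by (rule group_BijGroup)
  have "subgroup (graph_iso T T) (BijGroup (verts T))"
  proof (rule B.subgroupI)
    show "graph_iso T T \<noteq> {}"
      by (auto simp: graph_iso_def intro!: exI[of _ "\<lambda>x\<in>verts T. x"] simp: bij_betw_def inj_on_def)
    fix g assume g: "g \<in> graph_iso T T"
    then have "inv\<^bsub>BijGroup (verts T)\<^esub> g = restrict (inv_into (verts T) g) (verts T)"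
      using Bij by (intro inv_BijGroup) auto
    then show "inv\<^bsub>BijGroup (verts T)\<^esub> g \<in> graph_iso T T"
      using graph_iso_inverse[OF g] by simp
    fix h assume h: "h \<in> graph_iso T T"
    then show "g \<otimes>\<^bsub>BijGroup (verts T)\<^esub> h \<in> graph_iso T T"
      using graph_iso_compose[OF g h] Bij g by (auto simp: BijGroup_def)
  qed (use Bij in \<open>auto simp: BijGroup_def\<close>)
  from B.subgroup_imp_group[OF this] show ?thesis
    by (simp add: Aut_def)
qed

lemma Aut_simps:
  "carrier (Aut T) = graph_iso T T" "\<one>\<^bsub>Aut T\<^esub> = (\<lambda>x\<in>verts T. x)"
  "\<lbrakk>g \<in> graph_iso T T; h \<in> graph_iso T T\<rbrakk> \<Longrightarrow> g \<otimes>\<^bsub>Aut T\<^esub> h = compose (verts T) g h"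
  by (auto simp: Aut_def BijGroup_def graph_iso_def Bij_def)

section \<open>Germs of maps and the classes of honest almost automorphisms\<close>

locale almost_aut = leafless_tree T r for T :: "'v ugraph" and r +
  fixes G :: "('v \<Rightarrow> 'v) set"
  assumes G: "subgroup G (Aut T)"
begin

lemma G_iso: "g \<in> G \<Longrightarrow> g \<in> graph_iso T T"
  using subgroup.subset[OF G] by (auto simp: Aut_simps)

lemma G_in_V: "g \<in> G \<Longrightarrow> x \<in> V \<Longrightarrow> g x \<in> V"
  using G_iso graph_isoD(5) by metis

lemma G_mult: "g \<in> G \<Longrightarrow> h \<in> G \<Longrightarrow> g \<otimes>\<^bsub>Aut T\<^esub> h = compose V g h"
  using G_iso Aut_simps(3) by blast

lemma G_compose: "g \<in> G \<Longrightarrow> h \<in> G \<Longrightarrow> compose V g h \<in> G"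
  using subgroup.m_closed[OF G] G_mult by metis

lemma G_id: "(\<lambda>x\<in>V. x) \<in> G"
  using subgroup.one_closed[OF G] by (simp add: Aut_simps)

lemma G_inverse:
  assumes "g \<in> G"
  shows "\<exists>h\<in>G. \<forall>x\<in>V. h (g x) = x \<and> g (h x) = x"
proof
  let ?h = "inv\<^bsub>Aut T\<^esub> g"
  show h: "?h \<in> G" using subgroup.m_inv_closed[OF G assms] .
  have gA: "g \<in> carrier (Aut T)" using G_iso[OF assms] by (simp add: Aut_simps)
  have "compose V ?h g = (\<lambda>x\<in>V. x)" "compose V g ?h = (\<lambda>x\<in>V. x)"
    using group.l_inv[OF group_Aut gA] group.r_inv[OF group_Aut gA] G_mult h assms
    by (simp_all add: Aut_simps)
  then show "\<forall>x\<in>V. ?h (g x) = x \<and> g (?h x) = x"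
    by (metis compose_eq restrict_apply')
qed

text \<open>Equality of germs at infinity. Maps of forests are extensional with cofinite domain, so
  the default values off the domain affect only finitely many vertices, and maps with different
  domains can be compared.\<close>

definition near :: "('v \<Rightarrow> 'v) \<Rightarrow> ('v \<Rightarrow> 'v) \<Rightarrow> bool" where
  "near \<phi> \<psi> \<longleftrightarrow> finite {x \<in> V. \<phi> x \<noteq> \<psi> x}"

lemma nearI: "finite D \<Longrightarrow> (\<And>x. x \<in> V \<Longrightarrow> x \<notin> D \<Longrightarrow> \<phi> x = \<psi> x) \<Longrightarrow> near \<phi> \<psi>"
  unfolding near_def by (rule finite_subset[of _ D]) auto

lemma near_refl: "near \<phi> \<phi>"
  by (simp add: near_def)

lemma near_sym: "near \<phi> \<psi> \<Longrightarrow> near \<psi> \<phi>"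
  by (simp add: near_def eq_commute)

lemma near_trans: "near \<phi> \<psi> \<Longrightarrow> near \<psi> \<chi> \<Longrightarrow> near \<phi> \<chi>"
  by (rule nearI[of "{x \<in> V. \<phi> x \<noteq> \<psi> x} \<union> {x \<in> V. \<psi> x \<noteq> \<chi> x}"]) (auto simp: near_def)

text \<open>The exceptions of the outer map pull back to a finite set because \<psi> is injective on
  the cofinite set \<open>W\<close>.\<close>

lemma near_compose:
  assumes "near \<phi> \<phi>'" "near \<psi> \<psi>'" "finite (V - W)" "inj_on \<psi> W" "\<psi> ` W \<subseteq> V"
  shows "near (\<phi> \<circ> \<psi>) (\<phi>' \<circ> \<psi>')"
proof (rule nearI)
  let ?D = "(V - W) \<union> {x \<in> V. \<psi> x \<noteq> \<psi>' x} \<union> (\<psi> -` {y \<in> V. \<phi> y \<noteq> \<phi>' y} \<inter> W)"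
  have "finite (\<psi> -` {y \<in> V. \<phi> y \<noteq> \<phi>' y} \<inter> W)"
    using assms(1,4) finite_vimage_IntI unfolding near_def by blast
  then show "finite ?D"
    using assms(2,3) by (simp add: near_def)
  show "(\<phi> \<circ> \<psi>) x = (\<phi>' \<circ> \<psi>') x" if "x \<in> V" "x \<notin> ?D" for x
    using that assms(5) by auto
qed

lemma honest_iff:
  "(S\<^sub>1, \<phi>, S\<^sub>2) \<in> honest T r \<longleftrightarrow> complete_subtree T r S\<^sub>1 \<and> complete_subtree T r S\<^sub>2 \<and>
     \<phi> \<in> extensional (F S\<^sub>1) \<and> bij_betw \<phi> (F S\<^sub>1) (F S\<^sub>2) \<and>
     (\<forall>u\<in>F S\<^sub>1. \<forall>v\<in>F S\<^sub>1. adj T u v \<longleftrightarrow> adj T (\<phi> u) (\<phi> v))"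
proof (cases "complete_subtree T r S\<^sub>1 \<and> complete_subtree T r S\<^sub>2 \<and> bij_betw \<phi> (F S\<^sub>1) (F S\<^sub>2)")
  case True
  then have "adj (forest_compl T r S\<^sub>1) u v \<longleftrightarrow> adj T u v"
    "adj (forest_compl T r S\<^sub>2) (\<phi> u) (\<phi> v) \<longleftrightarrow> adj T (\<phi> u) (\<phi> v)"
    if "u \<in> F S\<^sub>1" "v \<in> F S\<^sub>1" for u v
    using that adj_forest bij_betwE[of \<phi> "F S\<^sub>1" "F S\<^sub>2"] by simp_all
  with True show ?thesis
    by (auto simp: honest_def graph_iso_def)
qed (auto simp: honest_def graph_iso_def)

lemma honestD:
  assumes "(S\<^sub>1, \<phi>, S\<^sub>2) \<in> honest T r"
  shows "complete_subtree T r S\<^sub>1" "complete_subtree T r S\<^sub>2" "\<phi> \<in> extensional (F S\<^sub>1)"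
    "bij_betw \<phi> (F S\<^sub>1) (F S\<^sub>2)" "inj_on \<phi> (F S\<^sub>1)" "\<phi> ` F S\<^sub>1 = F S\<^sub>2"
    "finite (V - F S\<^sub>1)" "finite (V - F S\<^sub>2)"
    "\<lbrakk>u \<in> F S\<^sub>1; v \<in> F S\<^sub>1\<rbrakk> \<Longrightarrow> adj T (\<phi> u) (\<phi> v) \<longleftrightarrow> adj T u v"
  using assms finite_compl_F by (auto simp: honest_iff bij_betw_def)

text \<open>Settles the case excluded in \<open>complete_cofinite\<close>: the only complete subtree
  is \<open>{r}\<close>, its forest is the whole tree, and there is a single honest map.\<close>

lemma one_vertex_honest:
  assumes "V = {r}" "(S\<^sub>1, \<phi>, S\<^sub>2) \<in> honest T r"
  shows "S\<^sub>1 = {r}" "S\<^sub>2 = {r}" "\<phi> x = (if x = r then r else undefined)"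
proof -
  have S: "S = {r}" if "complete_subtree T r S" for S
    using complete_rooted[OF that] assms(1) by (auto simp: rooted_def)
  have "leaves T r {r} = {r}"
    by (auto simp: leaves_def children_iff)
  then have F: "F {r} = {r}"
    using branch_root assms(1) by (simp add: forest_compl_def)
  show "S\<^sub>1 = {r}" "S\<^sub>2 = {r}"
    using S honestD(1,2)[OF assms(2)] by blast+
  then have "\<phi> \<in> extensional {r}" "\<phi> ` {r} = {r}"
    using honestD(3,6)[OF assms(2)] F by auto
  then show "\<phi> x = (if x = r then r else undefined)"
    by (auto simp: extensional_def)
qed

lemma aaut_rel_iff:
  "((S\<^sub>1, \<phi>, S\<^sub>2), (S\<^sub>1', \<phi>', S\<^sub>2')) \<in> aaut_rel T r \<longleftrightarrow>
     (S\<^sub>1, \<phi>, S\<^sub>2) \<in> honest T r \<and> (S\<^sub>1', \<phi>', S\<^sub>2') \<in> honest T r \<and> near \<phi> \<phi>'"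
proof (cases "(S\<^sub>1, \<phi>, S\<^sub>2) \<in> honest T r \<and> (S\<^sub>1', \<phi>', S\<^sub>2') \<in> honest T r")
  case True
  note h = True[THEN conjunct1] and h' = True[THEN conjunct2]
  have "(\<exists>S. complete_subtree T r S \<and> S\<^sub>1 \<union> S\<^sub>1' \<subseteq> S \<and> (\<forall>x\<in>F S. \<phi> x = \<phi>' x)) \<longleftrightarrow> near \<phi> \<phi>'"
    (is "?L \<longleftrightarrow> _")
  proof
    assume ?L
    then obtain S where "complete_subtree T r S" "\<forall>x\<in>F S. \<phi> x = \<phi>' x" by blast
    then show "near \<phi> \<phi>'"
      using finite_compl_F by (intro nearI[of "V - F S"]) auto
  next
    assume near: "near \<phi> \<phi>'"
    show ?L
    proof (cases "V = {r}")
      case True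
      then show ?thesis
        using one_vertex_honest[OF True h] one_vertex_honest[OF True h'] honestD(1)[OF h]
        by (intro exI[of _ "{r}"]) simp
    next
      case False
      \<comment> \<open>The exceptional vertices must also avoid the forest of \<open>S\<close>,
        which contains the leaves of \<open>S\<close>; lying in \<open>S\<close> alone would not
        do.\<close>
      let ?D = "S\<^sub>1 \<union> S\<^sub>1' \<union> {x \<in> V. \<phi> x \<noteq> \<phi>' x}"
      have "finite ?D" "?D \<subseteq> V"
        using near honestD(1)[OF h] honestD(1)[OF h']
        by (auto simp: near_def complete_subtree_def subtree_def)
      from complete_cofinite[OF False this] obtain S where
        S: "complete_subtree T r S" "?D \<subseteq> S" "F S \<inter> ?D = {}" by blast
      have "\<phi> x = \<phi>' x" if "x \<in> F S" for x
        using S(3) F_subset[of S] that by blast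
      with S show ?thesis by blast
    qed
  qed
  with True show ?thesis by (auto simp: aaut_rel_def)
qed (auto simp: aaut_rel_def)

abbreviation cls where "cls \<rho> \<equiv> aaut_rel T r `` {\<rho>}"

lemma cls_eq_iff:
  assumes "(S\<^sub>1, \<phi>, S\<^sub>2) \<in> honest T r" "(S\<^sub>1', \<phi>', S\<^sub>2') \<in> honest T r"
  shows "cls (S\<^sub>1, \<phi>, S\<^sub>2) = cls (S\<^sub>1', \<phi>', S\<^sub>2') \<longleftrightarrow> near \<phi> \<phi>'"
proof
  assume "cls (S\<^sub>1, \<phi>, S\<^sub>2) = cls (S\<^sub>1', \<phi>', S\<^sub>2')"
  moreover have "(S\<^sub>1', \<phi>', S\<^sub>2') \<in> cls (S\<^sub>1', \<phi>', S\<^sub>2')"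
    using assms by (simp add: aaut_rel_iff near_refl)
  ultimately have "(S\<^sub>1', \<phi>', S\<^sub>2') \<in> cls (S\<^sub>1, \<phi>, S\<^sub>2)" by simp
  then show "near \<phi> \<phi>'" by (simp add: aaut_rel_iff)
next
  assume n: "near \<phi> \<phi>'"
  have "near \<phi> \<chi> \<longleftrightarrow> near \<phi>' \<chi>" for \<chi>
    using near_trans near_sym n by blast
  then show "cls (S\<^sub>1, \<phi>, S\<^sub>2) = cls (S\<^sub>1', \<phi>', S\<^sub>2')"
    using assms by (auto simp: aaut_rel_iff)
qed

lemma honest_compose:
  assumes "(S\<^sub>2, \<phi>, S\<^sub>3) \<in> honest T r" "(S\<^sub>1, \<psi>, S\<^sub>2) \<in> honest T r"
  shows "(S\<^sub>1, compose (F S\<^sub>1) \<phi> \<psi>, S\<^sub>3) \<in> honest T r"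
  using assms graph_iso_compose by (auto simp: honest_def)

lemma near_compose_honest:
  assumes "(S\<^sub>1, \<psi>, S\<^sub>2) \<in> honest T r" "near \<phi> \<phi>'" "near \<psi> \<psi>'"
  shows "near (\<phi> \<circ> \<psi>) (\<phi>' \<circ> \<psi>')"
  using near_compose[OF assms(2,3) honestD(7,5)[OF assms(1)]] honestD(6)[OF assms(1)] F_subset by auto

lemma near_compose_restrict:
  assumes "complete_subtree T r S"
  shows "near (compose (F S) \<phi> \<psi>) (\<phi> \<circ> \<psi>)"
  using finite_compl_F[OF assms] by (intro nearI[of "V - F S"]) (auto simp: compose_def)

text \<open>Composition respects germs, so the union that defines the product runs over one class
  only.\<close>

lemma mult_cls:
  assumes \<phi>: "(S\<^sub>2, \<phi>, S\<^sub>3) \<in> honest T r" and \<psi>: "(S\<^sub>1, \<psi>, S\<^sub>2) \<in> honest T r"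
  shows "cls (S\<^sub>2, \<phi>, S\<^sub>3) \<otimes>\<^bsub>AAut T r\<^esub> cls (S\<^sub>1, \<psi>, S\<^sub>2) = cls (S\<^sub>1, compose (F S\<^sub>1) \<phi> \<psi>, S\<^sub>3)"
proof -
  let ?A = "{cls (R\<^sub>1, compose (F R\<^sub>1) \<phi>' \<psi>', R\<^sub>3) |R\<^sub>1 R\<^sub>2 R\<^sub>3 \<phi>' \<psi>'.
     (R\<^sub>2, \<phi>', R\<^sub>3) \<in> cls (S\<^sub>2, \<phi>, S\<^sub>3) \<and> (R\<^sub>1, \<psi>', R\<^sub>2) \<in> cls (S\<^sub>1, \<psi>, S\<^sub>2)}"
  let ?C = "cls (S\<^sub>1, compose (F S\<^sub>1) \<phi> \<psi>, S\<^sub>3)"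
  have "cls (R\<^sub>1, compose (F R\<^sub>1) \<phi>' \<psi>', R\<^sub>3) = ?C"
    if "(R\<^sub>2, \<phi>', R\<^sub>3) \<in> cls (S\<^sub>2, \<phi>, S\<^sub>3)" "(R\<^sub>1, \<psi>', R\<^sub>2) \<in> cls (S\<^sub>1, \<psi>, S\<^sub>2)" for R\<^sub>1 R\<^sub>2 R\<^sub>3 \<phi>' \<psi>'
  proof -
    have h: "(R\<^sub>2, \<phi>', R\<^sub>3) \<in> honest T r" "near \<phi> \<phi>'" "(R\<^sub>1, \<psi>', R\<^sub>2) \<in> honest T r" "near \<psi> \<psi>'"
      using that by (auto simp: aaut_rel_iff)
    have "near (compose (F R\<^sub>1) \<phi>' \<psi>') (compose (F S\<^sub>1) \<phi> \<psi>)"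
      using near_compose_honest[OF \<psi> h(2,4)] near_compose_restrict[OF honestD(1)[OF \<psi>], of \<phi> \<psi>]
        near_compose_restrict[OF honestD(1)[OF h(3)], of \<phi>' \<psi>'] near_trans near_sym by blast
    then show ?thesis
      using cls_eq_iff[OF honest_compose[OF h(1,3)] honest_compose[OF \<phi> \<psi>]] by simp
  qed
  moreover have "?C \<in> ?A"
    using \<phi> \<psi> by (intro CollectI exI[of _ S\<^sub>1] exI[of _ S\<^sub>2] exI[of _ S\<^sub>3] exI[of _ \<phi>] exI[of _ \<psi>])
      (auto simp: aaut_rel_iff near_refl)
  ultimately have "?A = {?C}" by blast
  then show ?thesis by (simp add: AAut_def)
qed

section \<open>\<open>G\<close>-honest maps, component by component\<close>

lemma leaf_branches_disjoint:
  assumes "complete_subtree T r S" "v \<in> leaves T r S" "w \<in> leaves T r S"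
    "x \<in> branch T r v" "x \<in> branch T r w"
  shows "v = w"
proof -
  have S: "rooted S" using complete_rooted assms by blast
  have *: "a = b" if ab: "a \<in> leaves T r S" "b \<in> leaves T r S" "a \<in> branch T r b" for a b
  proof (rule ccontr)
    assume "a \<noteq> b"
    then obtain c where c: "c \<in> children T r b" "a \<in> branch T r c"
      using branch_child ab by blast
    then have "c \<in> S"
      using rooted_branch[OF S, of a] ab by (auto simp: leaves_def)
    then show False using ab c by (auto simp: leaves_def)
  qed
  show ?thesis
    using branch_comparable[OF assms(4,5)] *[OF assms(2,3)] *[OF assms(3,2)] by blast
qed

lemma adj_same_leaf_branch:
  assumes "complete_subtree T r S" "u \<in> F S" "v \<in> F S" "adj T u v"
    "w \<in> leaves T r S" "u \<in> branch T r w"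
  shows "v \<in> branch T r w"
proof -
  obtain w' where "w' \<in> leaves T r S" "u \<in> branch T r w'" "v \<in> branch T r w'"
    using assms(4) by (cases rule: adj_cases) (use forest_edge_in_branch[OF assms(1)] assms(2,3) in blast)+
  then show ?thesis
    using leaf_branches_disjoint[OF assms(1,5) _ assms(6)] by blast
qed

text \<open>A leaf branch is connected and \<phi> preserves adjacency, so the image stays in one
  component of the target forest. This is what allows the elements of \<open>G\<close> attached to
  the components to be inverted and composed.\<close>

lemma honest_branch:
  assumes "(S\<^sub>1, \<phi>, S\<^sub>2) \<in> honest T r" "v \<in> leaves T r S\<^sub>1"
  shows "\<exists>w\<in>leaves T r S\<^sub>2. \<phi> ` branch T r v \<subseteq> branch T r w"
proof -
  note h = honestD[OF assms(1)]
  have sub: "branch T r v \<subseteq> F S\<^sub>1" using assms by (auto simp: F_iff)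
  have "v \<in> V"
    using assms(2) h(1) by (auto simp: leaves_def complete_subtree_def subtree_def)
  then have "v \<in> F S\<^sub>1" using sub branch_self by blast
  then obtain w where w: "w \<in> leaves T r S\<^sub>2" "\<phi> v \<in> branch T r w"
    using h(6) F_iff by (metis imageI)
  have "x \<in> branch T r v \<longrightarrow> \<phi> x \<in> branch T r w" if "x \<in> V" for x
    using that
  proof (induction rule: vertex_induct)
    case base
    then show ?case using w root_branch[of v] by auto
  next
    case (step x)
    show ?case
    proof (intro impI)
      assume x: "x \<in> branch T r v"
      show "\<phi> x \<in> branch T r w"
      proof (cases "x = v")
        case False
        then have p: "parent x \<in> branch T r v" using x branch_iff[of x v] by blast
        have F: "x \<in> F S\<^sub>1" "parent x \<in> F S\<^sub>1" using x p sub by auto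
        then show ?thesis
          using adj_same_leaf_branch[OF h(2) _ _ _ w(1), of "\<phi> (parent x)" "\<phi> x"] step(3) p
            h(6) h(9)[OF F(2,1)] parent(2)[OF step(1,2)] by blast
      qed (use w in simp)
    qed
  qed
  then show ?thesis using w(1) branch_subset by blast
qed

lemma honest_inverse:
  assumes "(S\<^sub>1, \<phi>, S\<^sub>2) \<in> honest T r"
  shows "(S\<^sub>2, restrict (inv_into (F S\<^sub>1) \<phi>) (F S\<^sub>2), S\<^sub>1) \<in> honest T r"
  using assms graph_iso_inverse by (auto simp: honest_def)

lemma G_honest_iff:
  "(S\<^sub>1, \<phi>, S\<^sub>2) \<in> G_honest T r G \<longleftrightarrow> (S\<^sub>1, \<phi>, S\<^sub>2) \<in> honest T r \<and>
     (\<forall>v\<in>leaves T r S\<^sub>1. \<exists>g\<in>G. \<forall>x\<in>branch T r v. \<phi> x = g x)"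
  by (simp add: G_honest_def)

text \<open>The inverse maps each component of the target forest into one component of the source;
  there \<phi> is a single \<open>g\<close>, whose inverse in \<open>G\<close> serves.\<close>

lemma G_honest_inverse:
  assumes "(S\<^sub>1, \<phi>, S\<^sub>2) \<in> G_honest T r G"
  shows "\<exists>\<phi>'. (S\<^sub>2, \<phi>', S\<^sub>1) \<in> G_honest T r G \<and> (\<forall>x\<in>F S\<^sub>1. \<phi>' (\<phi> x) = x) \<and> (\<forall>y\<in>F S\<^sub>2. \<phi> (\<phi>' y) = y)"
proof -
  let ?\<phi>' = "restrict (inv_into (F S\<^sub>1) \<phi>) (F S\<^sub>2)"
  have hon: "(S\<^sub>1, \<phi>, S\<^sub>2) \<in> honest T r" using assms by (simp add: G_honest_iff)
  note h = honestD[OF hon] and h' = honest_inverse[OF hon]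
  have inv1: "?\<phi>' (\<phi> x) = x" if "x \<in> F S\<^sub>1" for x
    using that h(5,6) by auto
  have inv2: "\<phi> (?\<phi>' y) = y" if "y \<in> F S\<^sub>2" for y
    using that h(6) by (auto simp: f_inv_into_f)
  have "\<exists>g\<in>G. \<forall>y\<in>branch T r w. ?\<phi>' y = g y" if w: "w \<in> leaves T r S\<^sub>2" for w
  proof -
    obtain v where v: "v \<in> leaves T r S\<^sub>1" "?\<phi>' ` branch T r w \<subseteq> branch T r v"
      using honest_branch[OF h' w] by blast
    obtain g where g: "g \<in> G" "\<forall>x\<in>branch T r v. \<phi> x = g x"
      using assms v by (auto simp: G_honest_iff)
    obtain k where k: "k \<in> G" "\<forall>x\<in>V. k (g x) = x \<and> g (k x) = x"
      using G_inverse[OF g(1)] by blast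
    have "?\<phi>' y = k y" if y: "y \<in> branch T r w" for y
    proof -
      have "?\<phi>' y \<in> branch T r v" "y \<in> F S\<^sub>2"
        using v(2) y w F_iff by blast+
      then show ?thesis
        using g(2) k(2) inv2 branch_subset by (metis subsetD)
    qed
    with k(1) show ?thesis by blast
  qed
  then show ?thesis
    using h' inv1 inv2 by (intro exI[of _ ?\<phi>']) (simp add: G_honest_iff)
qed

lemma G_honest_compose:
  assumes "(S\<^sub>2, \<phi>, S\<^sub>3) \<in> G_honest T r G" "(S\<^sub>1, \<psi>, S\<^sub>2) \<in> G_honest T r G"
  shows "(S\<^sub>1, compose (F S\<^sub>1) \<phi> \<psi>, S\<^sub>3) \<in> G_honest T r G"
proof -
  have hon: "(S\<^sub>2, \<phi>, S\<^sub>3) \<in> honest T r" "(S\<^sub>1, \<psi>, S\<^sub>2) \<in> honest T r"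
    using assms by (simp_all add: G_honest_iff)
  have "\<exists>k\<in>G. \<forall>x\<in>branch T r v. compose (F S\<^sub>1) \<phi> \<psi> x = k x" if v: "v \<in> leaves T r S\<^sub>1" for v
  proof -
    obtain w where w: "w \<in> leaves T r S\<^sub>2" "\<psi> ` branch T r v \<subseteq> branch T r w"
      using honest_branch[OF hon(2) v] by blast
    obtain g where g: "g \<in> G" "\<forall>x\<in>branch T r v. \<psi> x = g x"
      using assms(2) v by (auto simp: G_honest_iff)
    obtain h where h: "h \<in> G" "\<forall>x\<in>branch T r w. \<phi> x = h x"
      using assms(1) w(1) by (auto simp: G_honest_iff)
    have "compose (F S\<^sub>1) \<phi> \<psi> x = compose V h g x" if x: "x \<in> branch T r v" for x
    proof -
      have "x \<in> F S\<^sub>1" "x \<in> V" using x v F_iff branch_subset by blast+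
      then show ?thesis using x g(2) h(2) w(2) by (auto simp: compose_eq image_subset_iff)
    qed
    then show ?thesis using G_compose[OF h(1) g(1)] by blast
  qed
  then show ?thesis using honest_compose[OF hon] by (simp add: G_honest_iff)
qed

text \<open>Piecewise membership in \<open>G\<close> without a target tree: by
  \<open>G_honest_pieces\<close> it holds for every \<open>I\<close> that contains the tree of the
  domain, before anything is known about the image of \<open>V - I\<close>.\<close>

definition pieces :: "'v set \<Rightarrow> ('v \<Rightarrow> 'v) \<Rightarrow> bool" where
  "pieces I \<phi> \<longleftrightarrow> (\<forall>v\<in>V. v \<notin> I \<longrightarrow> v \<noteq> r \<longrightarrow> parent v \<in> I \<longrightarrow> (\<exists>g\<in>G. \<forall>x\<in>branch T r v. \<phi> x = g x))"

lemma G_honest_pieces: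
  assumes "(S\<^sub>1, \<phi>, S\<^sub>2) \<in> G_honest T r G" "S\<^sub>1 \<subseteq> I"
  shows "pieces I \<phi>"
  unfolding pieces_def
proof (intro ballI impI)
  fix v assume v: "v \<in> V" "v \<notin> I"
  have "complete_subtree T r S\<^sub>1" using assms by (auto simp: G_honest_iff dest: honestD)
  then obtain u where u: "u \<in> leaves T r S\<^sub>1" "v \<in> branch T r u"
    using V_subset_F v assms(2) F_iff by blast
  then show "\<exists>g\<in>G. \<forall>x\<in>branch T r v. \<phi> x = g x"
    using assms(1) branch_trans[OF _ u(2)] by (fastforce simp: G_honest_iff)
qed

text \<open>An automorphism carries the only edge that leaves the branch to the only edge that
  enters its image.\<close>

lemma image_branch_crossing:
  assumes "g \<in> graph_iso T T" "adj T x y" "x \<notin> g ` branch T r v" "y \<in> g ` branch T r v"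
  shows "x = g (parent v)"
proof -
  note g = graph_isoD[OF assms(1)]
  obtain y' where y': "y' \<in> branch T r v" "y = g y'" using assms by blast
  obtain x' where x': "x' \<in> V" "x = g x'" using g(4) adjD[OF assms(2)] by blast
  have "adj T y' x'" using g(6)[of y' x'] y' x' branch_subset assms(2) adj_sym[of T] by auto
  moreover have "x' \<notin> branch T r v" using assms(3) x' by blast
  ultimately show ?thesis using branch_crossing[of y' x' v] y'(1) x'(2) by blast
qed

text \<open>
  The image of each piece is entered through a single edge, and the root lies outside; so the
  geodesic from the root to a vertex of the image passes through that edge, and the complement
  of the image is closed under parents.
\<close>

lemma rooted_compl_image:
  assumes \<phi>: "pieces I \<phi>" and I: "rooted I" and im: "\<phi> ` (V - I) \<subseteq> V" "r \<notin> \<phi> ` (V - I)"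
  shows "rooted (V - \<phi> ` (V - I))"
proof -
  have "parent y \<notin> \<phi> ` (V - I)" if y: "y \<in> V" "y \<notin> \<phi> ` (V - I)" "y \<noteq> r" for y
  proof
    assume "parent y \<in> \<phi> ` (V - I)"
    then obtain x where x: "x \<in> V" "x \<notin> I" "parent y = \<phi> x" by blast
    obtain v where v: "v \<in> V" "v \<notin> I" "v \<noteq> r" "parent v \<in> I" "x \<in> branch T r v"
      using boundary_branch[OF I x(1,2)] by blast
    obtain g where g: "g \<in> G" "\<forall>x\<in>branch T r v. \<phi> x = g x"
      using \<phi> v unfolding pieces_def by blast
    let ?H = "g ` branch T r v"
    have "branch T r v \<subseteq> V - I"
      using rooted_branch[OF I] v(2) branch_subset by blast
    then have H: "?H \<subseteq> \<phi> ` (V - I)" using g(2) by (metis image_cong image_mono)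
    have py: "parent y \<in> ?H" using x v g by auto
    note par = parent[OF y(1,3)]
    have y_eq: "y = g (parent v)"
      using image_branch_crossing[OF G_iso[OF g(1)] par(1)] y(2) py H by blast
    obtain p where p: "geodesic T r p (parent y)" using connected root par by blast
    obtain a b where "a \<in> set p" "adj T a b" "a \<notin> ?H" "b \<in> ?H"
      using walk_crosses[of T r p "parent y" ?H] p py im(2) H unfolding geodesic_def by blast
    \<comment> \<open>The geodesic has to enter the image through \<open>y\<close>, but
      \<open>y\<close> is farther from the root than \<open>parent y\<close>, where the geodesic
      ends.\<close>
    then have "y \<in> set p"
      using image_branch_crossing[OF G_iso[OF g(1)]] y_eq by blast
    then show False
      using gdist_geodesic_less[OF p, of y] par by auto
  qed
  then show ?thesis using im(2) root parent(4) by (auto simp: rooted_def)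
qed

text \<open>Quantifying over all large \<open>I\<close> allows two maps to be restricted to a common
  domain. The target is forced: \<open>J\<close> has to be the complement of the image.\<close>

lemma G_honest_restrict:
  assumes "V \<noteq> {r}" "(S\<^sub>1, \<phi>, S\<^sub>2) \<in> G_honest T r G"
  shows "\<exists>A. finite A \<and> A \<subseteq> V \<and> (\<forall>I. finite I \<longrightarrow> rooted I \<longrightarrow> A \<subseteq> I \<longrightarrow>
     (\<exists>J. finite J \<and> rooted J \<and> (thick I, restrict \<phi> (V - I), thick J) \<in> G_honest T r G))"
\<comment> \<open>\<open>S\<^sub>1\<close> keeps \<open>V - I\<close> inside the domain of \<phi>;
  the preimage of \<open>r\<close> keeps \<open>r\<close> out of the image, as
  \<open>rooted_compl_image\<close> demands.\<close>
proof (rule exI[of _ "S\<^sub>1 \<union> {x \<in> F S\<^sub>1. \<phi> x = r}"], intro conjI allI impI)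
  have hon: "(S\<^sub>1, \<phi>, S\<^sub>2) \<in> honest T r" using assms by (simp add: G_honest_iff)
  note h = honestD[OF hon]
  let ?A = "S\<^sub>1 \<union> {x \<in> F S\<^sub>1. \<phi> x = r}"
  have "finite {x \<in> F S\<^sub>1. \<phi> x = r}"
    using finite_vimage_IntI[of "{r}", OF _ h(5)] by (simp add: vimage_def Int_def conj_commute)
  then show "finite ?A" using h(1) by (simp add: complete_subtree_def)
  show "?A \<subseteq> V" using h(1) F_subset by (auto simp: complete_subtree_def subtree_def)
  fix I assume I: "finite I" "rooted I" "?A \<subseteq> I"
  let ?J = "V - \<phi> ` (V - I)"
  have VI: "V - I \<subseteq> F S\<^sub>1" using V_subset_F[OF h(1)] I(3) by blast
  have im: "\<phi> ` (V - I) \<subseteq> V" using VI h(6) F_subset by blast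
  have "r \<notin> \<phi> ` (V - I)" using VI I(3) by blast
  then have J: "rooted ?J"
    using rooted_compl_image[OF G_honest_pieces[OF assms(2)] I(2) im] I(3) by blast
  \<comment> \<open>A vertex missed by the image of \<open>V - I\<close> is missed by \<phi>
    altogether or comes from \<open>I\<close>.\<close>
  have "?J \<subseteq> (V - F S\<^sub>2) \<union> \<phi> ` I" using h(6) F_subset[of S\<^sub>1] by blast
  then have finJ: "finite ?J" using h(8) I(1) by (auto intro: finite_subset)
  have F: "F (thick I) = V - I" "F (thick ?J) = \<phi> ` (V - I)"
    using F_thick[OF assms(1)] I(2) J im by auto
  have "bij_betw (restrict \<phi> (V - I)) (V - I) (\<phi> ` (V - I))"
    using inj_on_subset[OF h(5) VI] by (simp add: bij_betw_def inj_on_def)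
  then have "(thick I, restrict \<phi> (V - I), thick ?J) \<in> honest T r"
    unfolding honest_iff F using complete_thick[OF assms(1)] I J finJ h(9) VI by auto
  moreover have "\<forall>v\<in>leaves T r (thick I). \<exists>g\<in>G. \<forall>x\<in>branch T r v. restrict \<phi> (V - I) x = g x"
  proof
    fix v assume "v \<in> leaves T r (thick I)"
    then have v: "v \<in> V" "v \<notin> I" "v \<noteq> r" "parent v \<in> I"
      by (auto simp: leaves_thick[OF assms(1) I(2)])
    then have sub: "branch T r v \<subseteq> V - I"
      using rooted_branch[OF I(2)] branch_subset by blast
    have "pieces I \<phi>" using G_honest_pieces[OF assms(2)] I(3) by blast
    then obtain g where "g \<in> G" "\<forall>x\<in>branch T r v. \<phi> x = g x"
      using v unfolding pieces_def by blast
    then show "\<exists>g\<in>G. \<forall>x\<in>branch T r v. restrict \<phi> (V - I) x = g x"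
      using sub by (intro bexI[of _ g]) auto
  qed
  ultimately show "\<exists>J. finite J \<and> rooted J \<and> (thick I, restrict \<phi> (V - I), thick J) \<in> G_honest T r G"
    using J finJ by (intro exI[of _ ?J]) (simp add: G_honest_iff)
qed

text \<open>A product needs the image of \<psi> to be the domain of \<phi>. Restricting \<phi> and
  the inverse \<theta> of \<psi> to the same \<open>V - I\<close>, and inverting \<theta> again,
  gives such a pair with unchanged germs.\<close>

lemma G_honest_match:
  assumes \<phi>: "(S\<^sub>2, \<phi>, S\<^sub>3) \<in> G_honest T r G" and \<psi>: "(S\<^sub>1, \<psi>, S\<^sub>2') \<in> G_honest T r G"
  shows "\<exists>R\<^sub>1 R\<^sub>2 R\<^sub>3 \<phi>' \<psi>'. (R\<^sub>2, \<phi>', R\<^sub>3) \<in> G_honest T r G \<and> (R\<^sub>1, \<psi>', R\<^sub>2) \<in> G_honest T r G \<and>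
    near \<phi> \<phi>' \<and> near \<psi> \<psi>'"
proof (cases "V = {r}")
  case True
  have "S\<^sub>2 = S\<^sub>2'"
    using \<phi> \<psi> one_vertex_honest(1,2)[OF True] G_honest_iff by metis
  then show ?thesis using \<phi> \<psi> near_refl by blast
next
  case False
  have S2': "complete_subtree T r S\<^sub>2'" using \<psi> by (auto simp: G_honest_iff dest: honestD)
  obtain \<theta> where \<theta>: "(S\<^sub>2', \<theta>, S\<^sub>1) \<in> G_honest T r G" "\<forall>x\<in>F S\<^sub>1. \<theta> (\<psi> x) = x" "\<forall>y\<in>F S\<^sub>2'. \<psi> (\<theta> y) = y"
    using G_honest_inverse[OF \<psi>] by blast
  obtain A where A: "finite A" "A \<subseteq> V"
    "\<And>I. \<lbrakk>finite I; rooted I; A \<subseteq> I\<rbrakk> \<Longrightarrow> \<exists>J. finite J \<and> rooted J \<and> (thick I, restrict \<phi> (V - I), thick J) \<in> G_honest T r G"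
    using G_honest_restrict[OF False \<phi>] by blast
  obtain B where B: "finite B" "B \<subseteq> V"
    "\<And>I. \<lbrakk>finite I; rooted I; B \<subseteq> I\<rbrakk> \<Longrightarrow> \<exists>J. finite J \<and> rooted J \<and> (thick I, restrict \<theta> (V - I), thick J) \<in> G_honest T r G"
    using G_honest_restrict[OF False \<theta>(1)] by blast
  have "finite (A \<union> B \<union> S\<^sub>2')" "A \<union> B \<union> S\<^sub>2' \<subseteq> V"
    using A B S2' by (auto simp: complete_subtree_def subtree_def)
  from rooted_cover[OF this] obtain I where I: "finite I" "rooted I" "A \<subseteq> I" "B \<subseteq> I" "S\<^sub>2' \<subseteq> I"
    by blast
  obtain J where J: "(thick I, restrict \<phi> (V - I), thick J) \<in> G_honest T r G"
    using A(3)[OF I(1,2,3)] by blast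
  obtain K where K: "finite K" "rooted K" "(thick I, restrict \<theta> (V - I), thick K) \<in> G_honest T r G"
    using B(3)[OF I(1,2,4)] by blast
  have FI: "F (thick I) = V - I" "F (thick K) = V - K"
    using F_thick[OF False] I K by auto
  obtain \<psi>' where \<psi>': "(thick K, \<psi>', thick I) \<in> G_honest T r G"
    "\<forall>y\<in>V - K. restrict \<theta> (V - I) (\<psi>' y) = y"
    using G_honest_inverse[OF K(3)] unfolding FI by blast
  have maps: "\<psi>' x \<in> V - I" if "x \<in> V - K" for x
    using honestD(6)[of "thick K" \<psi>' "thick I"] \<psi>'(1) that unfolding FI by (auto simp: G_honest_iff)
  \<comment> \<open>Both maps invert \<theta>: apply \<psi> to the equation \<theta>(\<psi>'(x)) =
    x.\<close>
  have "\<psi> x = \<psi>' x" if x: "x \<in> V - K" for x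
  proof -
    have "\<theta> (\<psi>' x) = x" using \<psi>'(2) maps x by auto
    moreover have "\<psi>' x \<in> F S\<^sub>2'"
      using V_subset_F[OF S2'] maps[OF x] I(5) by blast
    ultimately show ?thesis using \<theta>(3) by force
  qed
  then have "near \<psi> \<psi>'" using K(1) by (intro nearI[of K]) auto
  moreover have "near \<phi> (restrict \<phi> (V - I))" using I(1) by (intro nearI[of I]) auto
  ultimately show ?thesis using J \<psi>'(1) by blast
qed

text \<open>Hides the two trees, which vary among the representatives of one class. The germ of any
  representative determines the class (\<open>rep_unique\<close>).\<close>

definition rep :: "'v aaut_rep set \<Rightarrow> ('v \<Rightarrow> 'v) \<Rightarrow> bool" where
  "rep X \<phi> \<longleftrightarrow> (\<exists>S\<^sub>1 S\<^sub>2. (S\<^sub>1, \<phi>, S\<^sub>2) \<in> G_honest T r G \<and> X = cls (S\<^sub>1, \<phi>, S\<^sub>2))"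

lemma carrier_F: "carrier (\<F> T r G) = {X. \<exists>\<phi>. rep X \<phi>}"
  by (auto simp: \<F>_def rep_def image_def)

lemma rep_unique: "rep X \<phi> \<Longrightarrow> rep Y \<psi> \<Longrightarrow> near \<phi> \<psi> \<Longrightarrow> X = Y"
  unfolding rep_def G_honest_iff by (elim exE conjE) (simp only: cls_eq_iff)

lemma rep_change:
  assumes "(R\<^sub>1, \<phi>', R\<^sub>2) \<in> G_honest T r G" "near \<phi> \<phi>'" "rep X \<phi>"
  shows "X = cls (R\<^sub>1, \<phi>', R\<^sub>2)"
  using rep_unique[OF assms(3) _ assms(2)] assms(1) by (auto simp: rep_def)

lemma rep_cofinite:
  assumes "rep X \<phi>"
  obtains W where "W \<subseteq> V" "finite (V - W)" "inj_on \<phi> W" "\<phi> ` W \<subseteq> V"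
proof -
  obtain S\<^sub>1 S\<^sub>2 where "(S\<^sub>1, \<phi>, S\<^sub>2) \<in> honest T r"
    using assms by (auto simp: rep_def G_honest_iff)
  note h = honestD[OF this]
  show thesis using that[of "F S\<^sub>1"] h(5-7) F_subset by auto
qed

lemma rep_near_compose:
  assumes "rep X \<psi>" "near \<phi> \<phi>'" "near \<psi> \<psi>'"
  shows "near (\<phi> \<circ> \<psi>) (\<phi>' \<circ> \<psi>')"
  by (rule rep_cofinite[OF assms(1)]) (use near_compose[OF assms(2,3)] in blast)

lemma rep_mult:
  assumes "rep X \<phi>" "rep Y \<psi>"
  shows "\<exists>\<chi>. rep (X \<otimes>\<^bsub>\<F> T r G\<^esub> Y) \<chi> \<and> near \<chi> (\<phi> \<circ> \<psi>)"
proof -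
  obtain S\<^sub>1 S\<^sub>2 S\<^sub>2' S\<^sub>3 where "(S\<^sub>2, \<phi>, S\<^sub>3) \<in> G_honest T r G" "(S\<^sub>1, \<psi>, S\<^sub>2') \<in> G_honest T r G"
    using assms by (auto simp: rep_def)
  then obtain R\<^sub>1 R\<^sub>2 R\<^sub>3 \<phi>' \<psi>' where R: "(R\<^sub>2, \<phi>', R\<^sub>3) \<in> G_honest T r G" "(R\<^sub>1, \<psi>', R\<^sub>2) \<in> G_honest T r G"
    "near \<phi> \<phi>'" "near \<psi> \<psi>'"
    using G_honest_match by meson
  then have "X \<otimes>\<^bsub>\<F> T r G\<^esub> Y = cls (R\<^sub>1, compose (F R\<^sub>1) \<phi>' \<psi>', R\<^sub>3)"
    using rep_change assms mult_cls[of R\<^sub>2 \<phi>' R\<^sub>3 R\<^sub>1 \<psi>'] by (simp add: \<F>_def G_honest_iff)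
  then have "rep (X \<otimes>\<^bsub>\<F> T r G\<^esub> Y) (compose (F R\<^sub>1) \<phi>' \<psi>')"
    using G_honest_compose[OF R(1,2)] by (auto simp: rep_def)
  moreover have "complete_subtree T r R\<^sub>1"
    using R(2) by (auto simp: G_honest_iff dest: honestD)
  then have "near (compose (F R\<^sub>1) \<phi>' \<psi>') (\<phi> \<circ> \<psi>)"
    using near_compose_restrict rep_near_compose[OF assms(2) R(3,4)] near_sym near_trans by blast
  ultimately show ?thesis by blast
qed

lemma rep_inverse:
  assumes "rep X \<phi>"
  shows "\<exists>Y \<psi>. rep Y \<psi> \<and> near (\<psi> \<circ> \<phi>) (\<lambda>x\<in>V. x)"
proof -
  obtain S\<^sub>1 S\<^sub>2 where S: "(S\<^sub>1, \<phi>, S\<^sub>2) \<in> G_honest T r G" using assms by (auto simp: rep_def)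
  then have "finite (V - F S\<^sub>1)" by (auto simp: G_honest_iff dest: honestD)
  moreover obtain \<psi> where "(S\<^sub>2, \<psi>, S\<^sub>1) \<in> G_honest T r G" "\<forall>x\<in>F S\<^sub>1. \<psi> (\<phi> x) = x"
    using G_honest_inverse[OF S] by blast
  ultimately show ?thesis
    by (intro exI[of _ "cls (S\<^sub>2, \<psi>, S\<^sub>1)"] exI[of _ \<psi>] conjI nearI[of "V - F S\<^sub>1"]) (auto simp: rep_def)
qed

text \<open>In the rooted sense \<open>r\<close> is a leaf of \<open>{r}\<close>, so the forest of
  \<open>{r}\<close> is all of \<open>T\<close>, and \<open>g\<close> itself, unrestricted,
  represents its class.\<close>

lemma rep_aut_class:
  assumes "g \<in> G"
  shows "rep (aut_class T r g) g"
proof -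
  have leaves: "leaves T r {r} = {r}"
    by (auto simp: leaves_def children_iff)
  then have F: "F {r} = V"
    using branch_root by (simp add: forest_compl_def)
  note g = graph_isoD[OF G_iso[OF assms]]
  have "subtree T {r}"
    using root by (intro rooted_subtree) (simp add: rooted_def)
  then have "complete_subtree T r {r}"
    using leaves by (simp add: complete_subtree_def)
  then have h: "({r}, g, {r}) \<in> honest T r"
    using g by (simp add: honest_iff F)
  then have Gh: "({r}, g, {r}) \<in> G_honest T r G"
    using leaves assms by (auto simp: G_honest_iff)
  have "cls (S\<^sub>1, restrict g (F S\<^sub>1), S\<^sub>2) = cls ({r}, g, {r})"
    if "(S\<^sub>1, restrict g (F S\<^sub>1), S\<^sub>2) \<in> honest T r" for S\<^sub>1 S\<^sub>2
    unfolding cls_eq_iff[OF that h] using honestD(7)[OF that] by (intro nearI[of "V - F S\<^sub>1"]) auto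
  moreover have "restrict g (F {r}) = g"
    using g(1) F by (simp add: extensional_restrict)
  ultimately have "{cls (S\<^sub>1, restrict g (F S\<^sub>1), S\<^sub>2) |S\<^sub>1 S\<^sub>2. (S\<^sub>1, restrict g (F S\<^sub>1), S\<^sub>2) \<in> honest T r}
      = {cls ({r}, g, {r})}"
    using h by (auto intro!: exI[of _ "{r}"])
  then have "aut_class T r g = cls ({r}, g, {r})"
    by (simp add: aut_class_def)
  with Gh show ?thesis by (auto simp: rep_def)
qed

text \<open>Reduces identities in \<F>(G) to composing maps up to finitely many vertices.\<close>

lemma rep_mult_eq:
  assumes "rep X \<phi>" "rep Y \<psi>" "rep Z \<chi>" "near (\<phi> \<circ> \<psi>) \<chi>"
  shows "X \<otimes>\<^bsub>\<F> T r G\<^esub> Y = Z"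
  using rep_mult[OF assms(1,2)] rep_unique[OF _ assms(3)] near_trans assms(4) by blast

lemma one_F: "\<one>\<^bsub>\<F> T r G\<^esub> = aut_class T r (\<lambda>x\<in>V. x)"
  by (simp add: \<F>_def AAut_def Aut_simps)

lemma group_F: "group (\<F> T r G)"
proof (rule groupI)
  fix X assume "X \<in> carrier (\<F> T r G)"
  then obtain \<phi> where X: "rep X \<phi>" by (auto simp: carrier_F)
  obtain W where W: "W \<subseteq> V" "finite (V - W)" "inj_on \<phi> W" "\<phi> ` W \<subseteq> V" by (rule rep_cofinite[OF X])
  note one = rep_aut_class[OF G_id]
  have "near ((\<lambda>x\<in>V. x) \<circ> \<phi>) \<phi>"
    using W by (intro nearI[of "V - W"]) auto
  from rep_mult_eq[OF one X X this] show "\<one>\<^bsub>\<F> T r G\<^esub> \<otimes>\<^bsub>\<F> T r G\<^esub> X = X"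
    by (simp add: one_F)
  obtain Y \<psi> where Y: "rep Y \<psi>" "near (\<psi> \<circ> \<phi>) (\<lambda>x\<in>V. x)" using rep_inverse[OF X] by blast
  from rep_mult_eq[OF Y(1) X one Y(2)] show "\<exists>Y\<in>carrier (\<F> T r G). Y \<otimes>\<^bsub>\<F> T r G\<^esub> X = \<one>\<^bsub>\<F> T r G\<^esub>"
    using Y by (auto simp: one_F carrier_F)
  fix Y assume "Y \<in> carrier (\<F> T r G)"
  then obtain \<psi> where Y: "rep Y \<psi>" by (auto simp: carrier_F)
  obtain \<phi>\<psi> where XY: "rep (X \<otimes>\<^bsub>\<F> T r G\<^esub> Y) \<phi>\<psi>" "near \<phi>\<psi> (\<phi> \<circ> \<psi>)" using rep_mult[OF X Y] by blast
  then show "X \<otimes>\<^bsub>\<F> T r G\<^esub> Y \<in> carrier (\<F> T r G)" by (auto simp: carrier_F)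
  fix Z assume "Z \<in> carrier (\<F> T r G)"
  then obtain \<chi> where Z: "rep Z \<chi>" by (auto simp: carrier_F)
  obtain \<psi>\<chi> where YZ: "rep (Y \<otimes>\<^bsub>\<F> T r G\<^esub> Z) \<psi>\<chi>" "near \<psi>\<chi> (\<psi> \<circ> \<chi>)" using rep_mult[OF Y Z] by blast
  obtain \<theta> where \<theta>: "rep (X \<otimes>\<^bsub>\<F> T r G\<^esub> (Y \<otimes>\<^bsub>\<F> T r G\<^esub> Z)) \<theta>" "near \<theta> (\<phi> \<circ> \<psi>\<chi>)"
    using rep_mult[OF X YZ(1)] by blast
  have "near (\<phi>\<psi> \<circ> \<chi>) (\<phi> \<circ> \<psi> \<circ> \<chi>)"
    by (rule rep_near_compose[OF Z XY(2) near_refl])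
  moreover have "near (\<phi> \<circ> \<psi>\<chi>) (\<phi> \<circ> (\<psi> \<circ> \<chi>))"
    by (rule rep_near_compose[OF YZ(1) near_refl YZ(2)])
  ultimately have "near (\<phi>\<psi> \<circ> \<chi>) \<theta>"
    using near_trans near_sym \<theta>(2) by (metis comp_assoc)
  from rep_mult_eq[OF XY(1) Z \<theta>(1) this]
  show "X \<otimes>\<^bsub>\<F> T r G\<^esub> Y \<otimes>\<^bsub>\<F> T r G\<^esub> Z = X \<otimes>\<^bsub>\<F> T r G\<^esub> (Y \<otimes>\<^bsub>\<F> T r G\<^esub> Z)" .
next
  show "\<one>\<^bsub>\<F> T r G\<^esub> \<in> carrier (\<F> T r G)"
    using rep_aut_class[OF G_id] by (auto simp: carrier_F one_F)
qed

lemma aut_class_mult: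
  assumes "g \<in> G" "h \<in> G"
  shows "aut_class T r g \<otimes>\<^bsub>\<F> T r G\<^esub> aut_class T r h = aut_class T r (compose V g h)"
  by (rule rep_mult_eq[OF rep_aut_class rep_aut_class rep_aut_class])
    (use assms G_compose in \<open>auto intro!: nearI[of "{}"] simp: compose_eq\<close>)

end

section \<open>Group topologies from conjugation-stable filters of subgroups\<close>

context topological_group
begin

lemma openin_preimage_translate:
  assumes "openin \<tau> U" "x \<in> carrier H"
  shows "openin \<tau> {y \<in> carrier H. x \<otimes> y \<in> U}"
proof -
  have "continuous_map \<tau> (prod_topology \<tau> \<tau>) (\<lambda>y. (x, y))"
    using assms(2) by (intro continuous_map_pairedI) (auto simp: topspace_eq)
  from continuous_map_compose[OF this continuous_mult]
  have "continuous_map \<tau> \<tau> (\<lambda>y. x \<otimes> y)" by (simp add: comp_def)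
  from openin_continuous_map_preimage[OF this assms(1)] show ?thesis
    by (simp add: topspace_eq)
qed

lemma openin_translate:
  assumes "openin \<tau> U" "x \<in> carrier H"
  shows "openin \<tau> (x <# U)"
proof -
  have U: "U \<subseteq> carrier H" using openin_subset[OF assms(1)] by (simp add: topspace_eq)
  have "y \<in> x <# U" if "y \<in> carrier H" "inv x \<otimes> y \<in> U" for y
    using that assms(2) m_assoc[of x "inv x" y] by (force simp: l_coset_def)
  moreover have "inv x \<otimes> (x \<otimes> u) = u" if "u \<in> U" for u
    using U that assms(2) m_assoc[of "inv x" x u] by auto
  ultimately have "x <# U = {y \<in> carrier H. inv x \<otimes> y \<in> U}"
    using U assms(2) by (auto simp: l_coset_def)
  then show ?thesis
    using openin_preimage_translate[OF assms(1), of "inv x"] assms(2) by simp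
qed

end

section \<open>The topology defined by the cosets of a family of subgroups\<close>

context group
begin

definition coset_open :: "'a set set \<Rightarrow> 'a set \<Rightarrow> bool" where
  "coset_open \<B> U \<longleftrightarrow> U \<subseteq> carrier G \<and> (\<forall>x\<in>U. \<exists>W\<in>\<B>. x <# W \<subseteq> U)"

context
  fixes \<B> :: "'a set set"
  assumes nonempty: "\<B> \<noteq> {}"
    and subgroups: "\<And>W. W \<in> \<B> \<Longrightarrow> subgroup W G"
    and directed: "\<And>W W'. W \<in> \<B> \<Longrightarrow> W' \<in> \<B> \<Longrightarrow> \<exists>W''\<in>\<B>. W'' \<subseteq> W \<inter> W'"
    and conjugation: "\<And>x W. x \<in> carrier G \<Longrightarrow> W \<in> \<B> \<Longrightarrow> \<exists>W'\<in>\<B>. \<forall>w\<in>W'. \<exists>w'\<in>W. x \<otimes> w = w' \<otimes> x"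
begin

lemma istopology_coset_open: "istopology (coset_open \<B>)"
  unfolding istopology_def
proof (intro conjI allI impI)
  fix U U' assume U: "coset_open \<B> U" "coset_open \<B> U'"
  have "\<exists>W\<in>\<B>. x <# W \<subseteq> U \<inter> U'" if x: "x \<in> U \<inter> U'" for x
  proof -
    obtain W W' where W: "W \<in> \<B>" "x <# W \<subseteq> U" "W' \<in> \<B>" "x <# W' \<subseteq> U'"
      using U x unfolding coset_open_def by blast
    obtain W'' where "W'' \<in> \<B>" "W'' \<subseteq> W \<inter> W'" using directed[OF W(1,3)] by blast
    moreover from this have "x <# W'' \<subseteq> U \<inter> U'" using W unfolding l_coset_def by blast
    ultimately show ?thesis by blast
  qed
  then show "coset_open \<B> (U \<inter> U')" using U by (auto simp: coset_open_def)
next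
  fix \<K> assume K: "\<forall>K\<in>\<K>. coset_open \<B> K"
  then show "coset_open \<B> (\<Union>\<K>)" unfolding coset_open_def by (meson Sup_least Sup_upper Union_iff order_trans)
qed

lemma openin_coset_topology: "openin (topology (coset_open \<B>)) = coset_open \<B>"
  by (rule topology_inverse'[OF istopology_coset_open])

lemma basis_in_carrier: "W \<in> \<B> \<Longrightarrow> w \<in> W \<Longrightarrow> w \<in> carrier G"
  by (rule subgroup.mem_carrier[OF subgroups])

text \<open>Around any \<open>y\<close> in \<open>x <# W\<close> the same \<open>W\<close> works,
  since it is closed under products.\<close>

lemma coset_open_coset:
  assumes "W \<in> \<B>" "x \<in> carrier G"
  shows "coset_open \<B> (x <# W)"
proof -
  have "\<exists>W'\<in>\<B>. y <# W' \<subseteq> x <# W" if y: "y \<in> x <# W" for y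
  proof (rule bexI[OF _ assms(1)], rule subsetI)
    fix z assume "z \<in> y <# W"
    then obtain w w' where "w \<in> W" "w' \<in> W" "z = (x \<otimes> w) \<otimes> w'"
      using y unfolding l_coset_def by blast
    then have "z = x \<otimes> (w \<otimes> w')" "w \<otimes> w' \<in> W"
      using assms basis_in_carrier subgroup.m_closed[OF subgroups[OF assms(1)]] by (auto simp: m_assoc)
    then show "z \<in> x <# W" unfolding l_coset_def by blast
  qed
  moreover have "x <# W \<subseteq> carrier G"
    using assms basis_in_carrier by (auto simp: l_coset_def)
  ultimately show ?thesis by (simp add: coset_open_def)
qed

lemma mem_coset: "W \<in> \<B> \<Longrightarrow> x \<in> carrier G \<Longrightarrow> x \<in> x <# W"
  using subgroup.one_closed[OF subgroups] by (force simp: l_coset_def)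

lemma topspace_coset_topology: "topspace (topology (coset_open \<B>)) = carrier G"
proof -
  obtain W where "W \<in> \<B>" using nonempty by blast
  moreover from this have "x <# W \<subseteq> carrier G" if "x \<in> carrier G" for x
    using that basis_in_carrier by (auto simp: l_coset_def)
  ultimately have "coset_open \<B> (carrier G)" by (auto simp: coset_open_def)
  then show ?thesis
    unfolding topspace_def openin_coset_topology by (auto simp: coset_open_def)
qed

text \<open>The assumption \<open>conjugation\<close> says that x W' x^-1 \<subseteq> W, written
  without inverses. It moves small elements past large ones: (x w')(y w) = (x y)(y^-1 w' y) w and (x
  w)^-1 = x^-1 (x w x^-1)^-1.\<close>

lemma topological_group_coset_topology: "topological_group G (topology (coset_open \<B>))"
proof -
  let ?\<tau> = "topology (coset_open \<B>)"
  note op = openin_coset_topology and ts = topspace_coset_topology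
  have mult: "continuous_map (prod_topology ?\<tau> ?\<tau>) ?\<tau> (\<lambda>(x, y). x \<otimes> y)"
    unfolding continuous_map_def
  proof (intro conjI allI impI)
    fix U assume "openin ?\<tau> U"
    then have U: "coset_open \<B> U" by (simp add: op)
    let ?P = "{p \<in> topspace (prod_topology ?\<tau> ?\<tau>). (case p of (x, y) \<Rightarrow> x \<otimes> y) \<in> U}"
    have "\<exists>A B. openin ?\<tau> A \<and> openin ?\<tau> B \<and> x \<in> A \<and> y \<in> B \<and> A \<times> B \<subseteq> ?P" if "(x, y) \<in> ?P" for x y
    proof -
      from that have xy: "x \<in> carrier G" "y \<in> carrier G" "x \<otimes> y \<in> U" by (auto simp: ts)
      obtain W where W: "W \<in> \<B>" "(x \<otimes> y) <# W \<subseteq> U" using U xy(3) by (auto simp: coset_open_def)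
      obtain W' where W': "W' \<in> \<B>" "\<forall>w\<in>W'. \<exists>w'\<in>W. inv y \<otimes> w = w' \<otimes> inv y"
        using conjugation[of "inv y" W] xy W by auto
      have "(x \<otimes> w') \<otimes> (y \<otimes> w) \<in> U" if w: "w' \<in> W'" "w \<in> W" for w' w
      proof -
        obtain u where u: "u \<in> W" "inv y \<otimes> w' = u \<otimes> inv y" using W'(2) w(1) by blast
        note c = basis_in_carrier[OF W(1) u(1)] basis_in_carrier[OF W(1) w(2)] basis_in_carrier[OF W'(1) w(1)]
        have "w' = y \<otimes> (inv y \<otimes> w')" using c xy by (simp add: m_assoc[symmetric])
        then have "w' \<otimes> y = y \<otimes> (u \<otimes> inv y) \<otimes> y" by (simp add: u(2))
        then have "w' \<otimes> y = y \<otimes> u" using c xy by (simp add: m_assoc)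
        then have "(x \<otimes> w') \<otimes> (y \<otimes> w) = (x \<otimes> y) \<otimes> (u \<otimes> w)"
          using c xy by (metis m_assoc m_closed)
        moreover have "u \<otimes> w \<in> W" using subgroup.m_closed[OF subgroups[OF W(1)]] u w by blast
        ultimately show ?thesis using W(2) unfolding l_coset_def by blast
      qed
      then have "(x <# W') \<times> (y <# W) \<subseteq> ?P"
        using xy basis_in_carrier W(1) W'(1) by (auto simp: l_coset_def ts)
      moreover have "openin ?\<tau> (x <# W')" "openin ?\<tau> (y <# W)" "x \<in> x <# W'" "y \<in> y <# W"
        using coset_open_coset mem_coset W(1) W'(1) xy(1,2) unfolding op by simp_all
      ultimately show ?thesis by meson
    qed
    then show "openin (prod_topology ?\<tau> ?\<tau>) ?P"
      unfolding openin_prod_topology_alt by blast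
  qed (auto simp: ts)
  have inv: "continuous_map ?\<tau> ?\<tau> (\<lambda>x. inv x)"
    unfolding continuous_map_def
  proof (intro conjI allI impI)
    fix U assume "openin ?\<tau> U"
    then have U: "coset_open \<B> U" by (simp add: op)
    have "\<exists>W\<in>\<B>. x <# W \<subseteq> {x \<in> carrier G. inv x \<in> U}" if x: "x \<in> carrier G" "inv x \<in> U" for x
    proof -
      obtain W where W: "W \<in> \<B>" "inv x <# W \<subseteq> U" using U x(2) by (auto simp: coset_open_def)
      obtain W' where W': "W' \<in> \<B>" "\<forall>w\<in>W'. \<exists>w'\<in>W. x \<otimes> w = w' \<otimes> x"
        using conjugation[OF x(1) W(1)] by blast
      have "inv (x \<otimes> w) \<in> U" if w: "w \<in> W'" for w
      proof -
        obtain u where u: "u \<in> W" "x \<otimes> w = u \<otimes> x" using W'(2) w by blast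
        have "inv (x \<otimes> w) = inv x \<otimes> inv u"
          using u x basis_in_carrier[OF W(1) u(1)] by (simp add: inv_mult_group)
        moreover have "inv u \<in> W" using subgroup.m_inv_closed[OF subgroups[OF W(1)] u(1)] .
        ultimately show ?thesis using W(2) unfolding l_coset_def by blast
      qed
      then show ?thesis
        using W'(1) x basis_in_carrier by (intro bexI[of _ W']) (auto simp: l_coset_def)
    qed
    then show "openin ?\<tau> {x \<in> topspace ?\<tau>. inv x \<in> U}"
      unfolding op ts by (auto simp: coset_open_def)
  qed (auto simp: ts)
  show ?thesis
    using mult inv ts by unfold_locales auto
qed

text \<open>The two conditions make \<B> a neighbourhood basis of the identity. Translations carry
  it to every point, so the open sets can only be those of \<open>coset_open\<close>.\<close>

theorem unique_group_topology:
  "\<exists>!\<tau>. topological_group G \<tau> \<and> (\<forall>W\<in>\<B>. openin \<tau> W) \<and> (\<forall>U. openin \<tau> U \<longrightarrow> \<one> \<in> U \<longrightarrow> (\<exists>W\<in>\<B>. W \<subseteq> U))"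
proof (rule ex1I)
  have one_coset: "\<one> <# W = W" if "W \<in> \<B>" for W
    using basis_in_carrier[OF that] by (force simp: l_coset_def)
  show "topological_group G (topology (coset_open \<B>)) \<and> (\<forall>W\<in>\<B>. openin (topology (coset_open \<B>)) W) \<and>
    (\<forall>U. openin (topology (coset_open \<B>)) U \<longrightarrow> \<one> \<in> U \<longrightarrow> (\<exists>W\<in>\<B>. W \<subseteq> U))"
    using topological_group_coset_topology coset_open_coset[of _ \<one>] one_coset
    unfolding openin_coset_topology by (force simp: coset_open_def)
next
  fix \<tau> assume \<tau>: "topological_group G \<tau> \<and> (\<forall>W\<in>\<B>. openin \<tau> W) \<and>
    (\<forall>U. openin \<tau> U \<longrightarrow> \<one> \<in> U \<longrightarrow> (\<exists>W\<in>\<B>. W \<subseteq> U))"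
  then interpret topological_group G \<tau> by blast
  have "openin \<tau> U \<longleftrightarrow> coset_open \<B> U" for U
  proof
    assume U: "openin \<tau> U"
    then have sub: "U \<subseteq> carrier G" using openin_subset topspace_eq by blast
    have "\<exists>W\<in>\<B>. x <# W \<subseteq> U" if x: "x \<in> U" for x
    proof -
      have "openin \<tau> {y \<in> carrier G. x \<otimes> y \<in> U}" "\<one> \<in> {y \<in> carrier G. x \<otimes> y \<in> U}"
        using openin_preimage_translate[OF U] x sub by auto
      then obtain W where "W \<in> \<B>" "W \<subseteq> {y \<in> carrier G. x \<otimes> y \<in> U}" using \<tau> by blast
      then show ?thesis by (intro bexI[of _ W]) (auto simp: l_coset_def)
    qed
    then show "coset_open \<B> U" using sub by (simp add: coset_open_def)
  next
    assume U: "coset_open \<B> U"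
    have "\<exists>V. openin \<tau> V \<and> x \<in> V \<and> V \<subseteq> U" if x: "x \<in> U" for x
    proof -
      obtain W where W: "W \<in> \<B>" "x <# W \<subseteq> U" "x \<in> carrier G"
        using U x unfolding coset_open_def by blast
      moreover have "openin \<tau> W" using W(1) \<tau> by blast
      ultimately show ?thesis
        using openin_translate[of W x] mem_coset[of W x] by blast
    qed
    then show "openin \<tau> U" by (subst openin_subopen) (intro ballI)
  qed
  then show "\<tau> = topology (coset_open \<B>)"
    by (simp add: topology_eq openin_coset_topology)
qed

end

end

section \<open>Tits' property and conjugation of fixators\<close>

context almost_aut
begin

text \<open>Strictness in \<open>gdist_branch_less\<close> makes the closest end unique, so the
  choice in \<open>proj\<close> is determined.\<close>

lemma proj_edge:
  assumes "v \<in> V" "v \<noteq> r" "x \<in> V"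
  shows "proj T {parent v, v} x = (if x \<in> branch T r v then v else parent v)"
  unfolding proj_def
  by (rule arg_minI[of _ "if x \<in> branch T r v then v else parent v"])
    (use gdist_branch_less[OF assms] in \<open>auto split: if_splits\<close>)

lemma path_branch_edge:
  assumes "v \<in> V" "v \<noteq> r" "x \<in> V"
  shows "x \<in> path_branch T {parent v, v} (if x \<in> branch T r v then v else parent v)"
  using proj_edge[OF assms] assms(3) by (auto simp: path_branch_def spanned_subtree_def)

lemma is_path_edge:
  assumes "v \<in> V" "v \<noteq> r"
  shows "is_path T {parent v, v}"
proof -
  let ?p = "\<lambda>i :: int. if i = 0 then parent v else v"
  have "{i..j} \<subseteq> {0, 1}" if "i \<in> {0, 1}" "j \<in> {0, 1}" for i j :: int
    using that by auto
  then show ?thesis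
    unfolding is_path_def using parent[OF assms] assms
    by (intro exI[of _ "{0, 1} :: int set"] exI[of _ ?p]) (auto simp: inj_on_def)
qed

text \<open>Surjectivity of the restriction map for the path \<open>{parent v, v}\<close>: prescribe
  \<open>g\<close> over \<open>v\<close> and the identity over \<open>parent v\<close>. Both come
  from the fixator of that path.\<close>

lemma tits_branch:
  assumes tits: "tits_independence T G" and v: "v \<in> V" "v \<noteq> r"
    and g: "g \<in> G" "g v = v" "g (parent v) = parent v"
  shows "\<exists>h\<in>G. (\<forall>x\<in>branch T r v. h x = g x) \<and> (\<forall>x\<in>V. x \<notin> branch T r v \<longrightarrow> h x = x)"
proof -
  let ?L = "{parent v, v}"
  let ?PB = "path_branch T ?L"
  let ?f = "\<lambda>g. \<lambda>w\<in>?L. restrict g (?PB w)"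
  let ?Fix = "fixator G ?L {}"
  let ?id = "\<lambda>x\<in>V. x"
  note par = parent[OF v]
  define fam where "fam = (\<lambda>w\<in>?L. restrict (if w = v then g else ?id) (?PB w))"
  have "(if w = v then g else ?id) \<in> ?Fix" for w
    using g G_id v par by (auto simp: fixator_def)
  then have fam: "fam \<in> (\<Pi>\<^sub>E w\<in>?L. (\<lambda>g. restrict g (?PB w)) ` ?Fix)"
    unfolding fam_def by (intro restrict_PiE_iff[THEN iffD2] ballI imageI)
  have image: "?f ` ?Fix = (\<Pi>\<^sub>E w\<in>?L. (\<lambda>g. restrict g (?PB w)) ` ?Fix)"
    using tits is_path_edge[OF v]
    by (auto simp: tits_independence_def iso_def bij_betw_def)
  have "fam \<in> ?f ` ?Fix" unfolding image by (rule fam)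
  then obtain h where h: "h \<in> ?Fix" "?f h = fam" by (elim imageE) simp
  have eq: "h x = (if w = v then g else ?id) x" if "w \<in> ?L" "x \<in> ?PB w" for w x
    using fun_cong[OF fun_cong[OF h(2), of w], of x] that by (simp add: fam_def)
  have "h x = g x" if x: "x \<in> branch T r v" for x
    using eq[of v x] path_branch_edge[OF v, of x] x branch_subset by auto
  moreover have "h x = x" if "x \<in> V" "x \<notin> branch T r v" for x
    using eq[of "parent v" x] path_branch_edge[OF v, of x] that par by auto
  ultimately show ?thesis using h(1) by (auto simp: fixator_def)
qed

text \<open>The conjugate by \<open>k\<close> of the part of \<open>g\<close> inside the branch at \<open>v\<close>, provided by Tits' property.\<close>

lemma conjugate_on_branch:
  assumes tits: "tits_independence T G" and v: "v \<in> V" "v \<noteq> r"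
    and g: "g \<in> G" "g v = v" "g (parent v) = parent v" and k: "k \<in> G"
  shows "\<exists>h\<in>G. (\<forall>x\<in>branch T r v. g x \<in> branch T r v \<and> h (k x) = k (g x)) \<and>
    (\<forall>y\<in>V. y \<notin> k ` branch T r v \<longrightarrow> h y = y)"
proof -
  obtain g' where g': "g' \<in> G" "\<forall>x\<in>branch T r v. g' x = g x"
    "\<And>x. x \<in> V \<Longrightarrow> x \<notin> branch T r v \<Longrightarrow> g' x = x"
    using tits_branch[OF tits v g] by blast
  obtain k' where k': "k' \<in> G" "\<forall>x\<in>V. k' (k x) = x \<and> k (k' x) = x"
    using G_inverse[OF k] by blast
  have inV: "x \<in> V" if "x \<in> branch T r v" for x using branch_subset that by blast
  \<comment> \<open>Otherwise \<open>g'\<close> fixes \<open>g' x\<close> without fixing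
    \<open>x\<close>, against injectivity.\<close>
  have stable: "g x \<in> branch T r v" if x: "x \<in> branch T r v" for x
  proof (rule ccontr)
    assume "g x \<notin> branch T r v"
    then have "g' (g' x) = g' x" "g' x \<noteq> x"
      using g' x G_in_V[OF g'(1) inV[OF x]] by auto
    then show False
      using graph_isoD(3)[OF G_iso[OF g'(1)]] G_in_V[OF g'(1)] inV[OF x] by (auto dest: inj_onD)
  qed
  let ?h = "compose V k (compose V g' k')"
  have "?h (k x) = k (g x)" if x: "x \<in> branch T r v" for x
    using k' g' x inV[OF x] G_in_V[OF k] by (simp add: compose_eq)
  moreover have "?h y = y" if y: "y \<in> V" "y \<notin> k ` branch T r v" for y
  proof -
    have "k' y \<notin> branch T r v" using y k'(2) by force
    then show ?thesis using y k' g' G_in_V[OF k'(1)] by (simp add: compose_eq)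
  qed
  moreover have "?h \<in> G" using G_compose k k'(1) g'(1) by blast
  ultimately show ?thesis using stable by blast
qed

text \<open>If \<open>v\<close> were a proper descendant of \<open>w\<close>, the vertex
  \<open>parent v\<close> of \<open>I\<close> would lie in the branch at \<open>w\<close>, which
  would put \<open>w\<close> into \<open>I\<close>.\<close>

lemma boundary_branches_disjoint:
  assumes "rooted I" "x \<in> branch T r v" "x \<in> branch T r w"
    "v \<in> V" "v \<notin> I" "v \<noteq> r" "parent v \<in> I" "w \<in> V" "w \<notin> I" "w \<noteq> r" "parent w \<in> I"
  shows "v = w"
proof -
  have *: "a = b" if "a \<in> branch T r b" "parent a \<in> I" "b \<notin> I" for a b
    using that branch_iff[of a b] rooted_branch[OF assms(1)] by blast
  show ?thesis
    using branch_comparable[OF assms(2,3)] *[of v w] *[of w v] assms by blast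
qed

text \<open>Vertices are enough: an automorphism that fixes both ends of an edge fixes the edge.
  \<open>openin_G_iff\<close> relies on this.\<close>

definition fixG :: "'v set \<Rightarrow> ('v \<Rightarrow> 'v) set" where
  "fixG A = {g \<in> G. \<forall>a\<in>A. g a = a}"

text \<open>Induction over the branches in \<open>D\<close>. Each factor moves only points in the
  \<phi>-image of its own branch, and injectivity of \<phi> makes these images disjoint, so the
  factors do not interfere. Fixing \<open>thick I\<close> means fixing each \<open>v\<close> in
  \<open>D\<close> and its parent.\<close>

lemma conjugate_pieces:
  assumes tits: "tits_independence T G" and I: "rooted I" and \<phi>: "pieces I \<phi>" "inj_on \<phi> (V - I)"
    and g: "g \<in> fixG (thick I)"
    and D: "finite D" "\<And>v. v \<in> D \<Longrightarrow> v \<in> V \<and> v \<notin> I \<and> v \<noteq> r \<and> parent v \<in> I"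
  shows "\<exists>h\<in>G. (\<forall>v\<in>D. \<forall>x\<in>branch T r v. g x \<in> branch T r v \<and> h (\<phi> x) = \<phi> (g x)) \<and>
    (\<forall>y\<in>V. y \<notin> \<phi> ` (\<Union>v\<in>D. branch T r v) \<longrightarrow> h y = y)"
  using D
proof (induction rule: finite_induct)
  case empty
  show ?case using G_id by (intro bexI[of _ "\<lambda>x\<in>V. x"]) auto
next
  case (insert v D)
  have v: "v \<in> V" "v \<notin> I" "v \<noteq> r" "parent v \<in> I" using insert.prems by auto
  have sub: "branch T r w \<subseteq> V - I" if "w \<in> insert v D" for w
    using rooted_branch[OF I] insert.prems[OF that] branch_subset by blast
  obtain h where h: "h \<in> G" "\<forall>v\<in>D. \<forall>x\<in>branch T r v. g x \<in> branch T r v \<and> h (\<phi> x) = \<phi> (g x)"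
    "\<forall>y\<in>V. y \<notin> \<phi> ` (\<Union>v\<in>D. branch T r v) \<longrightarrow> h y = y"
    using insert.IH[OF insert.prems[OF insertI2], simplified] by auto
  obtain k where k: "k \<in> G" "\<forall>x\<in>branch T r v. \<phi> x = k x"
    using \<phi>(1) v unfolding pieces_def by blast
  have "v \<in> thick I" "parent v \<in> thick I"
    using v by (auto simp: thick_def children_iff)
  then have "g \<in> G" "g v = v" "g (parent v) = parent v" using g by (auto simp: fixG_def)
  from conjugate_on_branch[OF tits v(1,3) this k(1)] obtain h' where h': "h' \<in> G"
    "\<forall>x\<in>branch T r v. g x \<in> branch T r v \<and> h' (k x) = k (g x)"
    "\<forall>y\<in>V. y \<notin> k ` branch T r v \<longrightarrow> h' y = y" by blast
  have kv: "k ` branch T r v = \<phi> ` branch T r v" using k(2) by force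
  have \<phi>V: "\<phi> x \<in> V" if wx: "w \<in> insert v D" "x \<in> branch T r w" for w x
  proof -
    obtain k where k: "k \<in> G" "\<forall>x\<in>branch T r w. \<phi> x = k x"
      using \<phi>(1) insert.prems[OF wx(1)] unfolding pieces_def by blast
    have "x \<in> V" using wx(2) branch_subset by blast
    then show ?thesis using G_in_V[OF k(1)] k(2) wx(2) by simp
  qed
  have disj: "\<phi> x \<noteq> \<phi> y" if "x \<in> branch T r v" "w \<in> D" "y \<in> branch T r w" for x y w
  proof
    assume "\<phi> x = \<phi> y"
    then have "x = y" using inj_onD[OF \<phi>(2)] sub that by blast
    then have "v = w"
      using boundary_branches_disjoint[OF I, of x v w] that v insert.prems[of w] by blast
    then show False using insert.hyps that by blast
  qed
  \<comment> \<open>\<open>h'\<close> acts first and keeps the point in the image of the branch at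
    \<open>v\<close>, where \<open>h\<close> is trivial.\<close>
  have "compose V h h' (\<phi> x) = \<phi> (g x)" if x: "x \<in> branch T r v" for x
  proof -
    have gx: "g x \<in> branch T r v" using h'(2) x by blast
    have "h' (\<phi> x) = \<phi> (g x)" using h'(2) k(2) x gx by auto
    moreover have "h (\<phi> (g x)) = \<phi> (g x)" using h(3) \<phi>V[of v] gx disj[OF gx] by blast
    ultimately show ?thesis using \<phi>V[of v] x by (simp add: compose_eq)
  qed
  \<comment> \<open>On the images of the earlier branches the roles are exchanged: \<open>h'\<close>
    is trivial and \<open>h\<close> acts.\<close>
  moreover have "compose V h h' (\<phi> x) = \<phi> (g x)" if w: "w \<in> D" "x \<in> branch T r w" for w x
  proof -
    have "\<phi> x \<notin> k ` branch T r v" using disj w unfolding kv by force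
    then have "h' (\<phi> x) = \<phi> x" using h'(3) \<phi>V[of w] w by blast
    then show ?thesis using h(2) \<phi>V[of w] w by (simp add: compose_eq)
  qed
  moreover have "compose V h h' y = y" if y: "y \<in> V" "y \<notin> \<phi> ` (\<Union>v\<in>insert v D. branch T r v)" for y
  proof -
    have "h' y = y" using h'(3) y unfolding kv by blast
    moreover have "h y = y" using h(3) y by blast
    ultimately show ?thesis using y by (simp add: compose_eq)
  qed
  moreover have "compose V h h' \<in> G" using G_compose h(1) h'(1) by blast
  ultimately show ?case using h(2) h'(2) by (intro bexI[of _ "compose V h h'"]) auto
qed

text \<open>\<open>thick I\<close> is the witness, where \<open>I\<close> absorbs the tree of the
  domain and the \<phi>-preimage of \<open>A\<close>. The conjugate moves only points of
  \<phi>(\<open>V - I\<close>), and these avoid \<open>A\<close>.\<close>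

lemma conjugate_fixators:
  assumes tits: "tits_independence T G" and X: "X \<in> carrier (\<F> T r G)" and A: "finite A" "A \<subseteq> V"
  shows "\<exists>B. finite B \<and> B \<subseteq> V \<and> (\<forall>g\<in>fixG B. \<exists>h\<in>fixG A.
    X \<otimes>\<^bsub>\<F> T r G\<^esub> aut_class T r g = aut_class T r h \<otimes>\<^bsub>\<F> T r G\<^esub> X)"
proof -
  obtain \<phi> where rep: "rep X \<phi>" using X by (auto simp: carrier_F)
  then obtain S\<^sub>1 S\<^sub>2 where S: "(S\<^sub>1, \<phi>, S\<^sub>2) \<in> G_honest T r G" by (auto simp: rep_def)
  then have hon: "(S\<^sub>1, \<phi>, S\<^sub>2) \<in> honest T r" by (simp add: G_honest_iff)
  note h = honestD[OF hon]
  have "finite (\<phi> -` A \<inter> F S\<^sub>1)" by (rule finite_vimage_IntI[OF A(1) h(5)])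
  then have "finite (S\<^sub>1 \<union> (\<phi> -` A \<inter> F S\<^sub>1))" "S\<^sub>1 \<union> (\<phi> -` A \<inter> F S\<^sub>1) \<subseteq> V"
    using h(1) F_subset by (auto simp: complete_subtree_def subtree_def)
  from rooted_cover[OF this] obtain I where I: "finite I" "rooted I" "S\<^sub>1 \<subseteq> I" "\<phi> -` A \<inter> F S\<^sub>1 \<subseteq> I"
    by blast
  have IV: "I \<subseteq> V" using I(2) by (simp add: rooted_def)
  have VI: "V - I \<subseteq> F S\<^sub>1" using V_subset_F[OF h(1)] I(3) by blast
  have inj: "inj_on \<phi> (V - I)" by (rule inj_on_subset[OF h(5) VI])
  have fin: "finite (thick I)" "thick I \<subseteq> V"
    using I(1) IV finite_children by (auto simp: thick_def children_iff)
  let ?D = "{v \<in> V. v \<notin> I \<and> v \<noteq> r \<and> parent v \<in> I}"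
  have D: "finite ?D"
    by (rule finite_subset[OF _ fin(1)]) (auto simp: thick_def children_iff)
  have "\<exists>h\<in>fixG A. X \<otimes>\<^bsub>\<F> T r G\<^esub> aut_class T r g = aut_class T r h \<otimes>\<^bsub>\<F> T r G\<^esub> X"
    if g: "g \<in> fixG (thick I)" for g
  proof -
    obtain h where hh: "h \<in> G" "\<forall>v\<in>?D. \<forall>x\<in>branch T r v. g x \<in> branch T r v \<and> h (\<phi> x) = \<phi> (g x)"
      "\<forall>y\<in>V. y \<notin> \<phi> ` (\<Union>v\<in>?D. branch T r v) \<longrightarrow> h y = y"
      using conjugate_pieces[OF tits I(2) G_honest_pieces[OF S I(3)] inj g D] by blast
    have "a \<notin> \<phi> ` (\<Union>v\<in>?D. branch T r v)" if a: "a \<in> A" for a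
    proof
      assume "a \<in> \<phi> ` (\<Union>v\<in>?D. branch T r v)"
      then obtain v x where x: "v \<in> ?D" "x \<in> branch T r v" "a = \<phi> x" by blast
      then have "x \<in> V - I" using rooted_branch[OF I(2)] branch_subset by blast
      then show False using I(4) VI a x(3) by blast
    qed
    then have hA: "h \<in> fixG A" using hh A(2) by (auto simp: fixG_def)
    have gG: "g \<in> G" using g by (simp add: fixG_def)
    have "\<phi> (g x) = h (\<phi> x)" if "x \<in> V" "x \<notin> I" for x
      using boundary_branch[OF I(2) that] hh(2) by force
    \<comment> \<open>Agreement off the finite set \<open>I\<close> is agreement of germs, hence an
      identity of classes.\<close>
    then have near: "near (\<phi> \<circ> g) (h \<circ> \<phi>)"
      using I(1) by (intro nearI[of I]) auto
    obtain \<chi> where \<chi>: "rep (aut_class T r h \<otimes>\<^bsub>\<F> T r G\<^esub> X) \<chi>" "near \<chi> (h \<circ> \<phi>)"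
      using rep_mult[OF rep_aut_class[OF hh(1)] rep] by blast
    have "X \<otimes>\<^bsub>\<F> T r G\<^esub> aut_class T r g = aut_class T r h \<otimes>\<^bsub>\<F> T r G\<^esub> X"
      by (rule rep_mult_eq[OF rep rep_aut_class[OF gG] \<chi>(1)]) (use near \<chi>(2) near_trans near_sym in blast)
    then show ?thesis using hA by blast
  qed
  then show ?thesis using fin by blast
qed

text \<open>In one direction the ends of the finitely many given edges are added to
  \<open>A\<close>. In the other an open subset of \<open>Aut T\<close> has to be found that cuts
  out \<open>U\<close>.\<close>

lemma openin_G_iff:
  "openin (subtopology (Aut_topology T) G) U \<longleftrightarrow>
     U \<subseteq> G \<and> (\<forall>g\<in>U. \<exists>A. finite A \<and> A \<subseteq> V \<and> (\<forall>h\<in>fixG A. compose V g h \<in> U))"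
proof
  assume "openin (subtopology (Aut_topology T) G) U"
  then obtain O' where O': "Aut_open T O'" "U = O' \<inter> G"
    by (auto simp: openin_subtopology openin_Aut_topology)
  have "\<exists>A. finite A \<and> A \<subseteq> V \<and> (\<forall>h\<in>fixG A. compose V g h \<in> U)" if g: "g \<in> U" for g
  proof -
    obtain A B where AB: "finite A" "A \<subseteq> V" "finite B" "B \<subseteq> edges T"
      "g <#\<^bsub>Aut T\<^esub> fixator (carrier (Aut T)) A B \<subseteq> O'"
      using O' g unfolding Aut_open_def by blast
    have edge: "\<exists>u\<in>V. \<exists>v\<in>V. e = {u, v}" if "e \<in> B" for e
    proof -
      have "edges T \<subseteq> {{u, v} |u v. u \<in> V \<and> v \<in> V \<and> u \<noteq> v}"
        using is_tree by (simp add: tree_def simple_graph_def)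
      then have "e \<in> {{u, v} |u v. u \<in> V \<and> v \<in> V \<and> u \<noteq> v}"
        using that AB(4) by (meson subsetD)
      then show ?thesis by blast
    qed
    have "finite e \<and> e \<subseteq> V" if "e \<in> B" for e
      using edge[OF that] by auto
    then have finB: "finite (\<Union>B)" "\<Union>B \<subseteq> V"
      using AB(3) by auto
    have "compose V g h \<in> U" if h: "h \<in> fixG (A \<union> \<Union>B)" for h
    proof -
      have "h ` e = e" if "e \<in> B" for e
        using h that by (force simp: fixG_def image_def)
      then have "h \<in> fixator (carrier (Aut T)) A B"
        using h G_iso by (auto simp: fixator_def fixG_def Aut_simps)
      then have "g \<otimes>\<^bsub>Aut T\<^esub> h \<in> O'" using AB(5) unfolding l_coset_def by blast
      moreover have "g \<in> G" "h \<in> G" using g h O'(2) by (auto simp: fixG_def)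
      ultimately show ?thesis using O'(2) G_mult G_compose by auto
    qed
    then show ?thesis using AB(1,2) finB by (intro exI[of _ "A \<union> \<Union>B"]) auto
  qed
  then show "U \<subseteq> G \<and> (\<forall>g\<in>U. \<exists>A. finite A \<and> A \<subseteq> V \<and> (\<forall>h\<in>fixG A. compose V g h \<in> U))"
    using O'(2) by blast
next
  assume U: "U \<subseteq> G \<and> (\<forall>g\<in>U. \<exists>A. finite A \<and> A \<subseteq> V \<and> (\<forall>h\<in>fixG A. compose V g h \<in> U))"
  then obtain A where A: "\<And>g. g \<in> U \<Longrightarrow> finite (A g) \<and> A g \<subseteq> V"
    "\<And>g h. g \<in> U \<Longrightarrow> h \<in> fixG (A g) \<Longrightarrow> compose V g h \<in> U"
    by metis
  \<comment> \<open>\<open>A g\<close> is a finite set chosen for \<open>g\<close>. Agreeing with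
    \<open>g\<close> on \<open>A g\<close> is an open condition on all automorphisms, in
    \<open>G\<close> or not.\<close>
  let ?O = "{f \<in> graph_iso T T. \<exists>g\<in>U. \<forall>a\<in>A g. f a = g a}"
  have "Aut_open T ?O"
    unfolding Aut_open_def
  proof (intro conjI ballI)
    fix f assume "f \<in> ?O"
    then obtain g where f: "f \<in> graph_iso T T" "g \<in> U" "\<forall>a\<in>A g. f a = g a" by blast
    have "f \<otimes>\<^bsub>Aut T\<^esub> k \<in> ?O" if "k \<in> fixator (carrier (Aut T)) (A g) {}" for k
      using that f graph_iso_compose[of f T T k T] A(1)[OF f(2)]
      by (auto simp: fixator_def Aut_simps compose_eq subset_eq intro!: bexI[of _ g])
    then have "f <#\<^bsub>Aut T\<^esub> fixator (carrier (Aut T)) (A g) {} \<subseteq> ?O"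
      unfolding l_coset_def by blast
    then show "\<exists>A B. finite A \<and> A \<subseteq> V \<and> finite B \<and> B \<subseteq> edges T \<and>
        f <#\<^bsub>Aut T\<^esub> fixator (carrier (Aut T)) A B \<subseteq> ?O"
      using A(1)[OF f(2)] by (intro exI[of _ "A g"] exI[of _ "{}"]) auto
  qed (auto simp: Aut_simps)
  moreover have "?O \<inter> G \<subseteq> U"
  proof
    fix f assume "f \<in> ?O \<inter> G"
    then obtain g where f: "f \<in> G" "g \<in> U" "\<forall>a\<in>A g. f a = g a" by blast
    then have gG: "g \<in> G" using U by blast
    obtain k where k: "k \<in> G" "\<forall>x\<in>V. k (g x) = x \<and> g (k x) = x" using G_inverse[OF gG] by blast
    \<comment> \<open>\<open>k\<close> inverts \<open>g\<close>, so f = g (g^-1 f) exhibits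
      \<open>f\<close> as \<open>g\<close> times an element of the fixator chosen for
      \<open>g\<close>.\<close>
    have "compose V k f \<in> fixG (A g)"
      using f k G_compose A(1)[OF f(2)] by (auto simp: fixG_def compose_eq subset_eq)
    then have "compose V g (compose V k f) \<in> U" using A(2) f(2) by blast
    moreover have "compose V g (compose V k f) = f"
      using k G_in_V[OF f(1)] graph_isoD(1)[OF G_iso[OF f(1)]]
      by (auto simp: compose_def extensional_def fun_eq_iff)
    ultimately show "f \<in> U" by simp
  qed
  moreover have "U \<subseteq> ?O \<inter> G" using U G_iso by blast
  ultimately have "Aut_open T ?O" "U = ?O \<inter> G" by blast+
  then show "openin (subtopology (Aut_topology T) G) U"
    unfolding openin_subtopology openin_Aut_topology by blast
qed

section \<open>The embedding of \<open>G\<close> and the neighbourhoods of the identity in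
  \<F>(G)\<close>

lemma openin_G_nbhd:
  assumes "openin (subtopology (Aut_topology T) G) U" "g \<in> U"
  obtains A where "finite A" "A \<subseteq> V" "\<And>h. h \<in> fixG A \<Longrightarrow> compose V g h \<in> U"
  using assms by (auto simp: openin_G_iff)

lemma fixG_compose: "g \<in> fixG A \<Longrightarrow> h \<in> fixG A \<Longrightarrow> A \<subseteq> V \<Longrightarrow> compose V g h \<in> fixG A"
  using G_compose by (auto simp: fixG_def compose_eq subset_eq)

lemma openin_fixG:
  assumes "finite A" "A \<subseteq> V"
  shows "openin (subtopology (Aut_topology T) G) (fixG A)"
  unfolding openin_G_iff using assms fixG_compose[OF _ _ assms(2)] by (auto simp: fixG_def)

lemma topspace_G: "topspace (subtopology (Aut_topology T) G) = G"
proof -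
  have "openin (subtopology (Aut_topology T) G) G"
    using openin_fixG[of "{}"] by (simp add: fixG_def)
  then have "G \<subseteq> topspace (subtopology (Aut_topology T) G)" by (rule openin_subset)
  then show ?thesis by auto
qed

lemma aut_class_closed: "g \<in> G \<Longrightarrow> aut_class T r g \<in> carrier (\<F> T r G)"
  using rep_aut_class by (auto simp: carrier_F)

lemma subgroup_aut_class_fixG:
  assumes "A \<subseteq> V"
  shows "subgroup (aut_class T r ` fixG A) (\<F> T r G)"
proof -
  interpret FG: group "\<F> T r G" by (rule group_F)
  have fixG_sub: "fixG A \<subseteq> G" by (auto simp: fixG_def)
  show ?thesis
  proof (rule FG.subgroupI)
    show "aut_class T r ` fixG A \<subseteq> carrier (\<F> T r G)"
      using fixG_sub aut_class_closed by blast
    have "(\<lambda>x\<in>V. x) \<in> fixG A" using G_id assms by (auto simp: fixG_def)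
    then show "aut_class T r ` fixG A \<noteq> {}" by blast
    fix X assume "X \<in> aut_class T r ` fixG A"
    then obtain g where g: "g \<in> fixG A" "X = aut_class T r g" by blast
    then have gG: "g \<in> G" using fixG_sub by blast
    obtain k where k: "k \<in> G" "\<forall>x\<in>V. k (g x) = x \<and> g (k x) = x" using G_inverse[OF gG] by blast
    have "k a = a" if a: "a \<in> A" for a
    proof -
      have "g a = a" "a \<in> V" using g a assms by (auto simp: fixG_def)
      then show ?thesis using k(2) by metis
    qed
    then have "k \<in> fixG A" using k(1) by (simp add: fixG_def)
    have "compose V k g = (\<lambda>x\<in>V. x)" using k(2) by (auto simp: compose_def)
    then have "aut_class T r k \<otimes>\<^bsub>\<F> T r G\<^esub> X = \<one>\<^bsub>\<F> T r G\<^esub>"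
      using aut_class_mult[OF k(1) gG] g(2) one_F by simp
    then have "inv\<^bsub>\<F> T r G\<^esub> X = aut_class T r k"
      using FG.inv_equality aut_class_closed k(1) gG g(2) by blast
    then show "inv\<^bsub>\<F> T r G\<^esub> X \<in> aut_class T r ` fixG A" using \<open>k \<in> fixG A\<close> by blast
    fix Y assume "Y \<in> aut_class T r ` fixG A"
    then obtain h where h: "h \<in> fixG A" "Y = aut_class T r h" by blast
    then show "X \<otimes>\<^bsub>\<F> T r G\<^esub> Y \<in> aut_class T r ` fixG A"
      using aut_class_mult[of g h] g fixG_compose[OF g(1) h(1) assms] fixG_sub by auto
  qed
qed

text \<open>For a group topology both properties can be tested at the identity, because
  \<open>aut_class\<close> is multiplicative and so carries left translations in \<open>G\<close> to
  left translations in \<F>(G). The right-hand side is the condition in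
  \<open>unique_group_topology\<close> for the images of the fixators.\<close>

lemma embedding_open_iff:
  assumes "topological_group (\<F> T r G) \<tau>"
  shows "continuous_map (subtopology (Aut_topology T) G) \<tau> (aut_class T r) \<and>
      open_map (subtopology (Aut_topology T) G) \<tau> (aut_class T r) \<longleftrightarrow>
    (\<forall>A. finite A \<and> A \<subseteq> V \<longrightarrow> openin \<tau> (aut_class T r ` fixG A)) \<and>
    (\<forall>U. openin \<tau> U \<longrightarrow> \<one>\<^bsub>\<F> T r G\<^esub> \<in> U \<longrightarrow> (\<exists>A. finite A \<and> A \<subseteq> V \<and> aut_class T r ` fixG A \<subseteq> U))"
    (is "?L \<longleftrightarrow> ?R")
proof -
  interpret FG: topological_group "\<F> T r G" \<tau> by fact
  let ?\<iota> = "aut_class T r" and ?\<sigma> = "subtopology (Aut_topology T) G"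
  have mult: "?\<iota> g \<otimes>\<^bsub>\<F> T r G\<^esub> ?\<iota> h = ?\<iota> (compose V g h)" if "g \<in> G" "h \<in> fixG A" for g h A
    using that aut_class_mult by (simp add: fixG_def)
  show ?thesis
  proof
    assume L: ?L
    have "\<exists>A. finite A \<and> A \<subseteq> V \<and> ?\<iota> ` fixG A \<subseteq> U" if U: "openin \<tau> U" "\<one>\<^bsub>\<F> T r G\<^esub> \<in> U" for U
    proof -
      have "openin ?\<sigma> {g \<in> G. ?\<iota> g \<in> U}"
        using L U(1) openin_continuous_map_preimage topspace_G by fastforce
      moreover have "(\<lambda>x\<in>V. x) \<in> {g \<in> G. ?\<iota> g \<in> U}" using U(2) G_id one_F by simp
      ultimately obtain A where A: "finite A" "A \<subseteq> V"
        "\<And>h. h \<in> fixG A \<Longrightarrow> compose V (\<lambda>x\<in>V. x) h \<in> {g \<in> G. ?\<iota> g \<in> U}"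
        by (rule openin_G_nbhd) blast
      have "?\<iota> h \<in> U" if h: "h \<in> fixG A" for h
      proof -
        have hG: "h \<in> G" using h by (simp add: fixG_def)
        have "compose V (\<lambda>x\<in>V. x) h = h"
          using G_in_V[OF hG] graph_isoD(1)[OF G_iso[OF hG]]
          by (auto simp: compose_def extensional_def fun_eq_iff)
        then show ?thesis using A(3)[OF h] by simp
      qed
      then show ?thesis using A(1,2) by blast
    qed
    moreover have "openin \<tau> (?\<iota> ` fixG A)" if "finite A" "A \<subseteq> V" for A
      using L openin_fixG[OF that] by (simp add: open_map_def)
    ultimately show ?R by simp
  next
    assume R: ?R
    have small: "\<exists>A. finite A \<and> A \<subseteq> V \<and> ?\<iota> ` fixG A \<subseteq> U" if "openin \<tau> U" "\<one>\<^bsub>\<F> T r G\<^esub> \<in> U" for U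
      using R that by blast
    have "continuous_map ?\<sigma> \<tau> ?\<iota>"
      unfolding continuous_map_def topspace_G
    proof (intro conjI allI impI)
      show "?\<iota> \<in> G \<rightarrow> topspace \<tau>" using aut_class_closed FG.topspace_eq by auto
      fix U assume U: "openin \<tau> U"
      have "\<exists>A. finite A \<and> A \<subseteq> V \<and> (\<forall>h\<in>fixG A. compose V g h \<in> {x \<in> G. ?\<iota> x \<in> U})"
        if g: "g \<in> G" "?\<iota> g \<in> U" for g
      proof -
        have "openin \<tau> {y \<in> carrier (\<F> T r G). ?\<iota> g \<otimes>\<^bsub>\<F> T r G\<^esub> y \<in> U}"
          by (rule FG.openin_preimage_translate[OF U aut_class_closed[OF g(1)]])
        then obtain A where A: "finite A" "A \<subseteq> V"
          "?\<iota> ` fixG A \<subseteq> {y \<in> carrier (\<F> T r G). ?\<iota> g \<otimes>\<^bsub>\<F> T r G\<^esub> y \<in> U}"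
          using small[of "{y \<in> carrier (\<F> T r G). ?\<iota> g \<otimes>\<^bsub>\<F> T r G\<^esub> y \<in> U}"] g aut_class_closed[OF g(1)]
          by auto
        have "compose V g h \<in> {x \<in> G. ?\<iota> x \<in> U}" if h: "h \<in> fixG A" for h
          using A(3) h mult[OF g(1) h] G_compose[OF g(1), of h] by (auto simp: fixG_def)
        then show ?thesis using A by blast
      qed
      then show "openin ?\<sigma> {x \<in> G. ?\<iota> x \<in> U}" unfolding openin_G_iff by blast
    qed
    moreover have "open_map ?\<sigma> \<tau> ?\<iota>"
      unfolding open_map_def
    proof (intro allI impI)
      fix U assume U: "openin ?\<sigma> U"
      have "\<exists>N. openin \<tau> N \<and> X \<in> N \<and> N \<subseteq> ?\<iota> ` U" if X: "X \<in> ?\<iota> ` U" for X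
      proof -
        obtain g where g: "g \<in> U" "X = ?\<iota> g" using X by blast
        obtain A where A: "finite A" "A \<subseteq> V" "\<And>h. h \<in> fixG A \<Longrightarrow> compose V g h \<in> U"
          by (rule openin_G_nbhd[OF U g(1)]) blast
        have gG: "g \<in> G" using openin_subset[OF U] g(1) topspace_G by blast
        have "openin \<tau> (?\<iota> ` fixG A)" using R A by blast
        then have "openin \<tau> (X <#\<^bsub>\<F> T r G\<^esub> (?\<iota> ` fixG A))"
          using FG.openin_translate aut_class_closed[OF gG] g(2) by blast
        moreover have "X \<otimes>\<^bsub>\<F> T r G\<^esub> \<one>\<^bsub>\<F> T r G\<^esub> \<in> X <#\<^bsub>\<F> T r G\<^esub> (?\<iota> ` fixG A)"
          using subgroup.one_closed[OF subgroup_aut_class_fixG[OF A(2)]] unfolding l_coset_def by blast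
        moreover have "X <#\<^bsub>\<F> T r G\<^esub> (?\<iota> ` fixG A) \<subseteq> ?\<iota> ` U"
          using A(3) mult[OF gG] g(2) by (auto simp: l_coset_def)
        moreover have "X \<otimes>\<^bsub>\<F> T r G\<^esub> \<one>\<^bsub>\<F> T r G\<^esub> = X"
          using aut_class_closed[OF gG] g(2) by simp
        ultimately show ?thesis by metis
      qed
      then show "openin \<tau> (?\<iota> ` U)" by (subst openin_subopen) (intro ballI)
    qed
    ultimately show ?L by blast
  qed
qed

lemma unique_topology_F:
  assumes tits: "tits_independence T G"
  shows "\<exists>!\<tau>. topological_group (\<F> T r G) \<tau> \<and>
    continuous_map (subtopology (Aut_topology T) G) \<tau> (aut_class T r) \<and>
    open_map (subtopology (Aut_topology T) G) \<tau> (aut_class T r)"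
proof -
  interpret FG: group "\<F> T r G" by (rule group_F)
  let ?\<A> = "{A. finite A \<and> A \<subseteq> V}"
  let ?\<B> = "(\<lambda>A. aut_class T r ` fixG A) ` ?\<A>"
  have "\<exists>W''\<in>?\<B>. W'' \<subseteq> W \<inter> W'" if W: "W \<in> ?\<B>" "W' \<in> ?\<B>" for W W'
  proof -
    obtain A A' where A: "A \<in> ?\<A>" "W = aut_class T r ` fixG A"
      "A' \<in> ?\<A>" "W' = aut_class T r ` fixG A'" using W by auto
    have "fixG (A \<union> A') \<subseteq> fixG A \<inter> fixG A'" by (auto simp: fixG_def)
    then have "aut_class T r ` fixG (A \<union> A') \<subseteq> W \<inter> W'" unfolding A(2,4) by blast
    moreover have "aut_class T r ` fixG (A \<union> A') \<in> ?\<B>" using A(1,3) by (intro imageI) simp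
    ultimately show ?thesis by (rule bexI)
  qed
  moreover have "\<exists>W'\<in>?\<B>. \<forall>w\<in>W'. \<exists>w'\<in>W. X \<otimes>\<^bsub>\<F> T r G\<^esub> w = w' \<otimes>\<^bsub>\<F> T r G\<^esub> X"
    if X: "X \<in> carrier (\<F> T r G)" and W: "W \<in> ?\<B>" for X W
  proof -
    obtain A where A: "finite A" "A \<subseteq> V" "W = aut_class T r ` fixG A" using W by auto
    obtain B where B: "finite B" "B \<subseteq> V" "\<forall>g\<in>fixG B. \<exists>h\<in>fixG A.
      X \<otimes>\<^bsub>\<F> T r G\<^esub> aut_class T r g = aut_class T r h \<otimes>\<^bsub>\<F> T r G\<^esub> X"
      using conjugate_fixators[OF tits X A(1,2)] by blast
    have "aut_class T r ` fixG B \<in> ?\<B>" using B(1,2) by (intro imageI) simp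
    moreover have "\<forall>w\<in>aut_class T r ` fixG B. \<exists>w'\<in>W. X \<otimes>\<^bsub>\<F> T r G\<^esub> w = w' \<otimes>\<^bsub>\<F> T r G\<^esub> X"
      unfolding A(3) using B(3) by simp
    ultimately show ?thesis by (rule bexI[rotated])
  qed
  moreover have "subgroup W (\<F> T r G)" if "W \<in> ?\<B>" for W
    using that subgroup_aut_class_fixG by auto
  moreover have "?\<B> \<noteq> {}" by blast
  ultimately have "\<exists>!\<tau>. topological_group (\<F> T r G) \<tau> \<and> (\<forall>W\<in>?\<B>. openin \<tau> W) \<and>
      (\<forall>U. openin \<tau> U \<longrightarrow> \<one>\<^bsub>\<F> T r G\<^esub> \<in> U \<longrightarrow> (\<exists>W\<in>?\<B>. W \<subseteq> U))"
    by (intro FG.unique_group_topology)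
  moreover have "(\<forall>W\<in>?\<B>. openin \<tau> W) \<and>
      (\<forall>U. openin \<tau> U \<longrightarrow> \<one>\<^bsub>\<F> T r G\<^esub> \<in> U \<longrightarrow> (\<exists>W\<in>?\<B>. W \<subseteq> U)) \<longleftrightarrow>
    continuous_map (subtopology (Aut_topology T) G) \<tau> (aut_class T r) \<and>
    open_map (subtopology (Aut_topology T) G) \<tau> (aut_class T r)"
    if "topological_group (\<F> T r G) \<tau>" for \<tau>
    unfolding embedding_open_iff[OF that] by simp
  \<comment> \<open>The equivalence depends on \<tau> being a group topology;
    \<open>conj_cong\<close> supplies this from the first conjunct.\<close>
  ultimately show ?thesis by (simp only: cong: conj_cong)
qed

end

theorem proposition2p22:
  fixes T :: "'v ugraph" and v\<^sub>0 :: 'v and G :: "('v \<Rightarrow> 'v) set"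
  assumes "tree T" and "locally_finite T" and "leafless T"
    and "v\<^sub>0 \<in> verts T" and "no_isolated_boundary_points T v\<^sub>0"
    and "subgroup G (Aut T)" and "closedin (Aut_topology T) G" and "tits_independence T G"
  shows "\<exists>!\<tau>. topological_group (\<F> T v\<^sub>0 G) \<tau> \<and>
           continuous_map (subtopology (Aut_topology T) G) \<tau> (aut_class T v\<^sub>0) \<and>
           open_map (subtopology (Aut_topology T) G) \<tau> (aut_class T v\<^sub>0)"
proof -
  interpret almost_aut T v\<^sub>0 G
    by (intro almost_aut.intro leafless_tree.intro rooted_tree.intro leafless_tree_axioms.intro
      almost_aut_axioms.intro assms)
  show ?thesis by (rule unique_topology_F) fact
qed

end
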